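(* The critical point $p_c$ of site percolation on the triangular lattice $\mathbb T$ equals $1/2$.
   Context: $\mathbb T$ denotes the triangular lattice in the complex plane (vertex set $\{k+\ell e^{i\pi/3}:k,\ell\in\mathbb Z\}$, with neighbors at distance $1$). Site percolation with parameter $p\in(0,1)$ is the random configuration in which each vertex (site) of $\mathbb T$ is open with probability $p$ and closed otherwise, independently of the others. A cluster is a connected component of open sites. The critical point $p_c\in(0,1)$ is the parameter such that for $p<p_c$ there is almost surely no infinite cluster, while for $p>p_c$ there is almost surely a (unique) infinite cluster. *)

theory Defs
  imports "HOL-Probability.Probability"
begin

definition tri_lattice :: "complex set" where
  "tri_lattice = {of_int k + of_int l * cis (pi / 3) | k l. True}"

definition tri_adj :: "complex \<Rightarrow> complex \<Rightarrow> bool" where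
  "tri_adj v w \<longleftrightarrow> v \<in> tri_lattice \<and> w \<in> tri_lattice \<and> dist v w = 1"

text \<open>A configuration \<open>\<omega>\<close> maps an open site to \<open>True\<close> and a closed one to \<open>False\<close>; its values
  outside the lattice are irrelevant.\<close>

definition site_percolation :: "real \<Rightarrow> (complex \<Rightarrow> bool) measure" where
  "site_percolation p = Pi\<^sub>M tri_lattice (\<lambda>_. measure_pmf (bernoulli_pmf p))"

definition open_sites :: "(complex \<Rightarrow> bool) \<Rightarrow> complex set" where
  "open_sites \<omega> = {v \<in> tri_lattice. \<omega> v}"

definition open_adj :: "(complex \<Rightarrow> bool) \<Rightarrow> complex \<Rightarrow> complex \<Rightarrow> bool" where
  "open_adj \<omega> v w \<longleftrightarrow> v \<in> open_sites \<omega> \<and> w \<in> open_sites \<omega> \<and> tri_adj v w"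

definition clusters :: "(complex \<Rightarrow> bool) \<Rightarrow> complex set set" where
  "clusters \<omega> = {{w. (open_adj \<omega>)\<^sup>*\<^sup>* v w} | v. v \<in> open_sites \<omega>}"

definition is_critical_point :: "real \<Rightarrow> bool" where
  "is_critical_point p_c \<longleftrightarrow>
     0 < p_c \<and> p_c < 1 \<and>
     (\<forall>p. 0 < p \<and> p < p_c \<longrightarrow>
        (AE \<omega> in site_percolation p. \<not> (\<exists>C \<in> clusters \<omega>. infinite C))) \<and>
     (\<forall>p. p_c < p \<and> p < 1 \<longrightarrow>
        (AE \<omega> in site_percolation p. \<exists>!C. C \<in> clusters \<omega> \<and> infinite C))"

end

theory Submission
  imports Defs
begin

text \<open>In lattice coordinates the graph is \<open>\<int>\<^sup>2\<close> with the neighbours \<open>\<plusminus>(1,0)\<close>, \<open>\<plusminus>(0,1)\<close>, \<open>\<plusminus>(1,-1)\<close>.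
  By Hex duality a rhombus has an open left-right crossing or a closed bottom-top crossing, but not
  both, so for \<open>p \<le> 1/2\<close> it is crossed with probability at most \<open>1/2\<close>.

  Let \<open>phi S p\<close> be the expected number of sites outside \<open>S\<close> adjacent to the cluster of the origin
  in \<open>S\<close>. If \<open>phi S q < 1\<close> for some \<open>S\<close>, then connection probabilities decay exponentially at \<open>q\<close>.
  Otherwise the differential inequality of Duminil-Copin and Tassion shows that there is percolation at
  all \<open>p > q\<close>. This is impossible for \<open>q < 1/2\<close>: the number of clusters touching the boundary of a
  box is at most the size of the boundary, so by Russo's formula sites whose opening joins two such
  clusters are rare at some \<open>p\<close> between \<open>q\<close> and \<open>1/2\<close>, whence the large clusters near the origin are connected
  to each other; with the square root trick a large rhombus would be crossed with probability
  greater than \<open>1/2\<close>.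

  For \<open>p < 1/2\<close>, exponential decay excludes infinite clusters. For \<open>p > 1/2\<close> it applies to the closed
  sites; by Borel-Cantelli all large rectangles of bounded aspect ratio are crossed by open paths the
  long way, and these crossings form a single infinite cluster that no other one can avoid.\<close>

section \<open>Expectations under finite product measures\<close>

text \<open>All estimates concern events that depend on finitely many sites, so probabilities are
  finite sums over subsets of a finite set, polynomial in \<open>p\<close>; the infinite product
  measure enters only through \<open>measure_cfg\<close>. The delicate point is that two distant
  arms must belong to one cluster. The counting argument bounds a total change over an interval of
  parameters, so it controls only some \<open>\<xi>\<close> between \<open>p\<close> and
  \<open>1 / 2\<close>, without saying where it lies or how it moves with the box. Everything else
  is arranged to survive the passage from \<open>p\<close> to \<open>\<xi>\<close>: the lower bounds
  on arms concern increasing events and are proved at \<open>p\<close>, the inner radius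
  \<open>k\<close> is fixed there before the box size is chosen, and the cost of altering the
  configuration inside \<open>block k\<close> is bounded uniformly in \<open>\<xi>\<close>. Above
  \<open>1 / 2\<close>, a closed path that blocks a rectangle must span its short side, so
  exponential decay beats the linear number of starting sites even for rectangles eight times longer
  than wide.\<close>

definition expec :: "'a set \<Rightarrow> real \<Rightarrow> ('a set \<Rightarrow> real) \<Rightarrow> real" where
  "expec V p f = (\<Sum>A\<in>Pow V. p ^ card A * (1 - p) ^ card (V - A) * f A)"

definition pr :: "'a set \<Rightarrow> real \<Rightarrow> ('a set \<Rightarrow> bool) \<Rightarrow> real" where
  "pr V p Q = expec V p (\<lambda>A. of_bool (Q A))"

lemma expec_empty [simp]: "expec {} p f = f {}"
  by (simp add: expec_def)

text \<open>Conditioning on the state of \<open>x\<close>: the induction step for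
  \<open>expec_Un\<close>, monotonicity in \<open>p\<close>, Harris' inequality and Russo's
  formula.\<close>

lemma expec_insert:
  assumes "finite V" "x \<notin> V"
  shows "expec (insert x V) p f = p * expec V p (\<lambda>A. f (insert x A)) + (1 - p) * expec V p f"
proof -
  let ?w = "\<lambda>W A. p ^ card A * (1 - p) ^ card (W - A) * f A"
  have disj: "Pow V \<inter> insert x ` Pow V = {}"
    using assms by auto
  have inj: "inj_on (insert x) (Pow V)"
    using assms by (auto simp: inj_on_def)
  have "expec (insert x V) p f = sum (?w (insert x V)) (Pow V) + sum (?w (insert x V)) (insert x ` Pow V)"
    unfolding expec_def Pow_insert using assms disj by (intro sum.union_disjoint) auto
  also have "sum (?w (insert x V)) (Pow V) = (1 - p) * expec V p f"
    unfolding expec_def sum_distrib_left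
  proof (intro sum.cong refl)
    fix A assume A: "A \<in> Pow V"
    then have "insert x V - A = insert x (V - A)"
      using assms by auto
    then have "card (insert x V - A) = Suc (card (V - A))"
      using assms by simp
    then show "?w (insert x V) A = (1 - p) * ?w V A" by simp
  qed
  also have "sum (?w (insert x V)) (insert x ` Pow V) = p * expec V p (\<lambda>A. f (insert x A))"
    unfolding expec_def sum_distrib_left
  proof (subst sum.reindex[OF inj], intro sum.cong refl)
    fix A assume A: "A \<in> Pow V"
    moreover from this have "finite A" "x \<notin> A"
      using assms by (auto dest: finite_subset)
    ultimately have "insert x V - insert x A = V - A" "card (insert x A) = Suc (card A)"
      using assms by auto
    then show "(?w (insert x V) \<circ> insert x) A =
        p * (p ^ card A * (1 - p) ^ card (V - A) * f (insert x A))" by simp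
  qed
  finally show ?thesis by simp
qed

lemma expec_cong:
  assumes "\<And>A. A \<subseteq> V \<Longrightarrow> f A = g A"
  shows "expec V p f = expec V p g"
  unfolding expec_def using assms by (intro sum.cong) auto

lemma pr_cong:
  assumes "\<And>A. A \<subseteq> V \<Longrightarrow> Q A = R A"
  shows "pr V p Q = pr V p R"
  unfolding pr_def using assms by (intro expec_cong) auto

lemma expec_add: "expec V p (\<lambda>A. f A + g A) = expec V p f + expec V p g"
  by (simp add: expec_def sum.distrib algebra_simps)

lemma expec_diff: "expec V p (\<lambda>A. f A - g A) = expec V p f - expec V p g"
  by (simp add: expec_def sum_subtractf algebra_simps)

lemma expec_cmult: "expec V p (\<lambda>A. c * f A) = c * expec V p f"
  by (simp add: expec_def sum_distrib_left algebra_simps)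

lemma expec_sum: "expec V p (\<lambda>A. \<Sum>i\<in>I. f i A) = (\<Sum>i\<in>I. expec V p (f i))"
  unfolding expec_def by (subst sum.swap) (simp add: sum_distrib_left)

lemma expec_const [simp]:
  assumes "finite V"
  shows "expec V p (\<lambda>_. c) = c"
  using assms by induction (auto simp: expec_insert algebra_simps)

lemma expec_mono:
  assumes "0 \<le> p" "p \<le> 1" "\<And>A. A \<subseteq> V \<Longrightarrow> f A \<le> g A"
  shows "expec V p f \<le> expec V p g"
  unfolding expec_def using assms by (intro sum_mono mult_left_mono) auto

lemma pr_mono:
  assumes "0 \<le> p" "p \<le> 1" "\<And>A. A \<subseteq> V \<Longrightarrow> Q A \<Longrightarrow> R A"
  shows "pr V p Q \<le> pr V p R"
  unfolding pr_def using assms by (intro expec_mono) auto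

lemma pr_nonneg: "0 \<le> p \<Longrightarrow> p \<le> 1 \<Longrightarrow> 0 \<le> pr V p Q"
  unfolding pr_def expec_def by (intro sum_nonneg) auto

lemma pr_le_1:
  assumes "finite V" "0 \<le> p" "p \<le> 1"
  shows "pr V p Q \<le> 1"
proof -
  have "pr V p Q \<le> expec V p (\<lambda>_. 1)"
    unfolding pr_def using assms by (intro expec_mono) auto
  then show ?thesis using assms by simp
qed

lemma pr_not:
  assumes "finite V"
  shows "pr V p (\<lambda>A. \<not> Q A) = 1 - pr V p Q"
proof -
  have "pr V p (\<lambda>A. \<not> Q A) = expec V p (\<lambda>A. 1 - of_bool (Q A))"
    unfolding pr_def by (intro expec_cong) auto
  then show ?thesis using assms by (simp add: expec_diff pr_def)
qed

lemma pr_disj_le: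
  assumes "0 \<le> p" "p \<le> 1"
  shows "pr V p (\<lambda>A. Q A \<or> R A) \<le> pr V p Q + pr V p R"
  unfolding pr_def expec_add[symmetric] using assms by (intro expec_mono) auto

lemma pr_Bex_le:
  assumes "0 \<le> p" "p \<le> 1" "finite I"
  shows "pr V p (\<lambda>A. \<exists>i\<in>I. Q i A) \<le> (\<Sum>i\<in>I. pr V p (Q i))"
  unfolding pr_def expec_sum[symmetric]
proof (intro expec_mono assms)
  fix A
  have "of_bool (\<exists>i\<in>I. Q i A) \<le> (\<Sum>i\<in>I. of_bool (Q i A) :: real)"
  proof (cases "\<exists>i\<in>I. Q i A")
    case True
    then obtain i where "i \<in> I" "Q i A" by auto
    then show ?thesis
      using member_le_sum[of i I "\<lambda>i. of_bool (Q i A) :: real"] assms by auto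
  qed (auto intro: sum_nonneg)
  then show "of_bool (\<exists>i\<in>I. Q i A) \<le> (\<Sum>i\<in>I. of_bool (Q i A) :: real)" .
qed

lemma expec_Un:
  assumes "finite V" "finite W" "V \<inter> W = {}"
  shows "expec (V \<union> W) p f = expec V p (\<lambda>A. expec W p (\<lambda>B. f (A \<union> B)))"
  using assms
proof (induction V arbitrary: f rule: finite_induct)
  case (insert x V)
  then have "x \<notin> V \<union> W" "V \<inter> W = {}" by auto
  with insert show ?case by (simp add: expec_insert)
qed simp

lemma expec_local:
  assumes "finite V" "W \<subseteq> V" "\<And>A. A \<subseteq> V \<Longrightarrow> f A = f (A \<inter> W)"
  shows "expec V p f = expec W p f"
proof -
  have fin: "finite W" "finite (V - W)"
    using assms by (auto dest: finite_subset)
  have "expec V p f = expec (W \<union> (V - W)) p f"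
    using assms by (simp add: Un_absorb1)
  also have "\<dots> = expec W p (\<lambda>A. expec (V - W) p (\<lambda>B. f (A \<union> B)))"
    using fin by (intro expec_Un) auto
  also have "\<dots> = expec W p (\<lambda>A. expec (V - W) p (\<lambda>B. f A))"
  proof (intro expec_cong)
    fix A B assume "A \<subseteq> W" "B \<subseteq> V - W"
    moreover from this have "(A \<union> B) \<inter> W = A" "A \<union> B \<subseteq> V"
      using assms(2) by auto
    ultimately show "f (A \<union> B) = f A"
      using assms(3) by metis
  qed
  finally show ?thesis using fin by simp
qed

lemma expec_indep:
  assumes "finite V" "U \<subseteq> V"
    and "\<And>A. A \<subseteq> V \<Longrightarrow> f A = f (A \<inter> U)" "\<And>A. A \<subseteq> V \<Longrightarrow> g A = g (A - U)"
  shows "expec V p (\<lambda>A. f A * g A) = expec V p f * expec V p g"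
proof -
  have fin: "finite U" "finite (V - U)"
    using assms by (auto dest: finite_subset)
  have eq: "f (A \<union> B) = f A" "g (A \<union> B) = g B" if "A \<subseteq> U" "B \<subseteq> V - U" for A B
  proof -
    have "(A \<union> B) \<inter> U = A" "(A \<union> B) - U = B" "A \<union> B \<subseteq> V"
      using that assms(2) by auto
    then show "f (A \<union> B) = f A" "g (A \<union> B) = g B"
      using assms(3)[of "A \<union> B"] assms(4)[of "A \<union> B"] by simp_all
  qed
  have "expec V p (\<lambda>A. f A * g A) = expec (U \<union> (V - U)) p (\<lambda>A. f A * g A)"
    using assms by (simp add: Un_absorb1)
  also have "\<dots> = expec U p (\<lambda>A. expec (V - U) p (\<lambda>B. f (A \<union> B) * g (A \<union> B)))"
    using fin by (intro expec_Un) auto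
  also have "\<dots> = expec U p (\<lambda>A. expec (V - U) p (\<lambda>B. f A * g B))"
    using eq by (intro expec_cong) simp
  also have "\<dots> = expec U p (\<lambda>A. expec (V - U) p g * f A)"
    by (intro expec_cong) (simp add: expec_cmult)
  also have "\<dots> = expec U p f * expec (V - U) p g"
    by (simp add: expec_cmult)
  also have "expec U p f = expec V p f"
    using assms by (intro expec_local[symmetric]) auto
  also have "expec (V - U) p g = expec V p g"
  proof (intro expec_local[symmetric])
    fix A assume "A \<subseteq> V"
    moreover from this have "A \<inter> (V - U) = A - U" by auto
    ultimately show "g A = g (A \<inter> (V - U))" using assms(4)[of A] by simp
  qed (use assms in auto)
  finally show ?thesis .
qed

lemma expec_image:
  assumes "inj_on \<pi> V" "finite V"
  shows "expec (\<pi> ` V) p f = expec V p (\<lambda>A. f (\<pi> ` A))"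
  using assms(2,1)
proof (induction V arbitrary: f rule: finite_induct)
  case (insert x V)
  then have "\<pi> x \<notin> \<pi> ` V" by auto
  with insert show ?case by (simp add: expec_insert)
qed simp

text \<open>Colour exchange: the closed sites form a percolation with parameter
  \<open>1 - p\<close>.\<close>

lemma expec_compl:
  assumes "finite V"
  shows "expec V p f = expec V (1 - p) (\<lambda>A. f (V - A))"
proof -
  have "expec V p f = (\<Sum>A\<in>Pow V. p ^ card (V - A) * (1 - p) ^ card (V - (V - A)) * f (V - A))"
    unfolding expec_def
    by (rule sum.reindex_bij_witness[of _ "\<lambda>A. V - A" "\<lambda>A. V - A"])
      (auto simp: double_diff)
  also have "\<dots> = expec V (1 - p) (\<lambda>A. f (V - A))"
    unfolding expec_def by (intro sum.cong) (auto simp: double_diff mult_ac)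
  finally show ?thesis .
qed

lemma mono_insert_arg: "mono f \<Longrightarrow> mono (\<lambda>A. f (insert x A))"
  by (intro monoI) (blast intro: monoD insert_mono)

lemma expec_mono_p:
  assumes "finite V" "mono f" "0 \<le> p" "p \<le> q" "q \<le> 1"
  shows "expec V p f \<le> expec V q f"
  using assms(1,2)
proof (induction V arbitrary: f rule: finite_induct)
  case (insert x V)
  let ?f1 = "\<lambda>A. f (insert x A)"
  have m: "mono ?f1"
    using insert.prems by (auto intro: mono_insert_arg)
  have le: "f A \<le> ?f1 A" for A
    using insert.prems by (auto intro: monoD)
  have "expec V p f \<le> expec V q f" "expec V p ?f1 \<le> expec V q ?f1"
    using insert m by auto
  moreover have "expec V p f \<le> expec V p ?f1"
    using le assms by (intro expec_mono) auto
  ultimately have "p * expec V p ?f1 + (1 - p) * expec V p f \<le> q * expec V p ?f1 + (1 - q) * expec V p f"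
    using mult_right_mono[of p q "expec V p ?f1 - expec V p f"] assms by (simp add: algebra_simps)
  also have "\<dots> \<le> q * expec V q ?f1 + (1 - q) * expec V q f"
    using \<open>expec V p f \<le> expec V q f\<close> \<open>expec V p ?f1 \<le> expec V q ?f1\<close> assms
    by (intro add_mono mult_left_mono) auto
  finally show ?case using insert by (simp add: expec_insert)
qed simp

text \<open>Given the state of \<open>x\<close>, the induction hypothesis applies on
  \<open>V\<close>. What remains is the covariance of two increasing functions of a single site,
  \<open>p * (1 - p) * ((?a1 - ?a) * (?b1 - ?b))\<close>, which is nonnegative.\<close>

lemma harris:
  assumes "finite V" "mono f" "mono g" "0 \<le> p" "p \<le> 1"
  shows "expec V p f * expec V p g \<le> expec V p (\<lambda>A. f A * g A)"
  using assms(1,2,3)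
proof (induction V arbitrary: f g rule: finite_induct)
  case (insert x V)
  let ?f1 = "\<lambda>A. f (insert x A)" and ?g1 = "\<lambda>A. g (insert x A)"
  let ?a = "expec V p f" and ?b = "expec V p g" and ?a1 = "expec V p ?f1" and ?b1 = "expec V p ?g1"
  have m: "mono ?f1" "mono ?g1"
    using insert.prems by (auto intro: mono_insert_arg)
  have "?a \<le> ?a1" "?b \<le> ?b1"
    using insert.prems assms by (auto intro!: expec_mono intro: monoD)
  then have "0 \<le> p * (1 - p) * ((?a1 - ?a) * (?b1 - ?b))"
    using assms by (intro mult_nonneg_nonneg) auto
  then have "(p * ?a1 + (1 - p) * ?a) * (p * ?b1 + (1 - p) * ?b) \<le> p * (?a1 * ?b1) + (1 - p) * (?a * ?b)"
    by (simp add: algebra_simps)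
  also have "\<dots> \<le> p * expec V p (\<lambda>A. ?f1 A * ?g1 A) + (1 - p) * expec V p (\<lambda>A. f A * g A)"
    using insert m assms by (intro add_mono mult_left_mono) auto
  finally show ?case using insert by (simp add: expec_insert)
qed simp

text \<open>Complements of increasing events are decreasing; \<open>harris\<close> is applied to
  their negated indicators, whose signs cancel in the products.\<close>

lemma pr_harris_not:
  assumes "finite V" "0 \<le> p" "p \<le> 1"
    and "\<And>A B. A \<subseteq> B \<Longrightarrow> Q A \<Longrightarrow> Q B" "\<And>A B. A \<subseteq> B \<Longrightarrow> R A \<Longrightarrow> R B"
  shows "pr V p (\<lambda>A. \<not> Q A) * pr V p (\<lambda>A. \<not> R A) \<le> pr V p (\<lambda>A. \<not> Q A \<and> \<not> R A)"
proof -
  have m: "mono (\<lambda>A. - of_bool (\<not> Q A) :: real)" "mono (\<lambda>A. - of_bool (\<not> R A) :: real)"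
    using assms(4,5) by (force simp: mono_def)+
  have eq: "expec V p (\<lambda>A. - of_bool (\<not> S A)) = - pr V p (\<lambda>A. \<not> S A)" for S
    using expec_cmult[of V p "-1"] by (simp add: pr_def)
  show ?thesis
    using harris[OF assms(1) m assms(2,3)] unfolding eq by (simp add: pr_def of_bool_conj)
qed

text \<open>The product rule applied to \<open>expec_insert\<close> yields the difference of the two
  conditional expectations, which is the summand of \<open>x\<close>; the induction hypothesis gives
  the others. The function \<open>f\<close> is arbitrary because the formula serves a cluster count
  as well as an event.\<close>

lemma russo:
  assumes "finite V"
  shows "((\<lambda>p. expec V p f) has_real_derivative
           (\<Sum>x\<in>V. expec V p (\<lambda>A. f (insert x A) - f (A - {x})))) (at p)"
  using assms
proof (induction V arbitrary: f rule: finite_induct)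
  case (insert x V)
  let ?f1 = "\<lambda>A. f (insert x A)"
  let ?D = "\<lambda>f. \<Sum>y\<in>V. expec V p (\<lambda>A. f (insert y A) - f (A - {y}))"
  have D: "((\<lambda>p. p * expec V p ?f1 + (1 - p) * expec V p f) has_real_derivative
          (expec V p ?f1 + p * ?D ?f1 + ((1 - p) * ?D f - expec V p f))) (at p)"
    by (rule DERIV_cong, (rule derivative_intros insert.IH)+) (simp add: algebra_simps)
  have x: "expec (insert x V) p (\<lambda>A. f (insert x A) - f (A - {x})) = expec V p ?f1 - expec V p f"
  proof -
    have "expec V p (\<lambda>A. f (A - {x})) = expec V p f"
      using insert by (intro expec_cong arg_cong[where f = f]) auto
    then show ?thesis
      using insert by (simp add: expec_insert expec_diff algebra_simps)
  qed
  have "expec (insert x V) p (\<lambda>A. f (insert y A) - f (A - {y})) =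
      p * expec V p (\<lambda>A. ?f1 (insert y A) - ?f1 (A - {y})) +
      (1 - p) * expec V p (\<lambda>A. f (insert y A) - f (A - {y}))" (is "?L y = _") if "y \<in> V" for y
  proof -
    have "insert x A - {y} = insert x (A - {y})" for A
      using insert that by auto
    then show ?thesis
      using insert by (simp add: expec_insert insert_commute)
  qed
  then have "(\<Sum>y\<in>V. ?L y) = p * ?D ?f1 + (1 - p) * ?D f"
    by (simp add: sum.distrib sum_distrib_left)
  with x have "((\<lambda>p. p * expec V p ?f1 + (1 - p) * expec V p f) has_real_derivative
          (\<Sum>y\<in>insert x V. ?L y)) (at p)"
    using insert by (intro DERIV_cong[OF D]) simp
  then show ?case
    using insert by (simp add: expec_insert)
qed simp

text \<open>Given the configuration off \<open>K\<close>, any prescribed pattern \<open>D\<close> on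
  \<open>K\<close> has probability at least \<open>m ^ card K\<close>, since each state of a site
  has probability at least \<open>m\<close>. Forcing \<open>Q\<close> by altering \<open>K\<close>
  thus costs only this factor.\<close>

lemma finite_energy:
  assumes "finite V" "K \<subseteq> V" "0 \<le> m" "m \<le> p" "m \<le> 1 - p"
  shows "m ^ card K * pr V p (\<lambda>A. \<exists>D\<subseteq>K. Q (A - K \<union> D)) \<le> pr V p Q"
proof -
  have fin: "finite K" "finite (V - K)"
    using assms by (auto dest: finite_subset)
  have V: "V = (V - K) \<union> K"
    using assms by auto
  have split: "pr V p R = expec (V - K) p (\<lambda>A. expec K p (\<lambda>B. of_bool (R (A \<union> B))))" for R
    unfolding pr_def by (subst V, rule expec_Un) (use fin in auto)
  have "m ^ card K * pr V p (\<lambda>A. \<exists>D\<subseteq>K. Q (A - K \<union> D)) =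
      expec (V - K) p (\<lambda>A. m ^ card K * expec K p (\<lambda>B. of_bool (\<exists>D\<subseteq>K. Q (A \<union> B - K \<union> D))))"
    unfolding split expec_cmult ..
  also have "\<dots> \<le> expec (V - K) p (\<lambda>A. expec K p (\<lambda>B. of_bool (Q (A \<union> B))))"
  proof (intro expec_mono)
    fix A assume A: "A \<subseteq> V - K"
    have "expec K p (\<lambda>B. of_bool (\<exists>D\<subseteq>K. Q (A \<union> B - K \<union> D))) =
        expec K p (\<lambda>B. of_bool (\<exists>D\<subseteq>K. Q (A \<union> D)))"
    proof (intro expec_cong)
      fix B assume "B \<subseteq> K"
      with A have "A \<union> B - K = A" by auto
      then show "of_bool (\<exists>D\<subseteq>K. Q (A \<union> B - K \<union> D)) = (of_bool (\<exists>D\<subseteq>K. Q (A \<union> D)) :: real)"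
        by simp
    qed
    then have eq: "expec K p (\<lambda>B. of_bool (\<exists>D\<subseteq>K. Q (A \<union> B - K \<union> D))) =
        of_bool (\<exists>D\<subseteq>K. Q (A \<union> D))"
      using fin by simp
    show "m ^ card K * expec K p (\<lambda>B. of_bool (\<exists>D\<subseteq>K. Q (A \<union> B - K \<union> D)))
        \<le> expec K p (\<lambda>B. of_bool (Q (A \<union> B)))"
    proof (cases "\<exists>D\<subseteq>K. Q (A \<union> D)")
      case True
      then obtain D where D: "D \<subseteq> K" "Q (A \<union> D)" by auto
      have "card K = card D + card (K - D)"
        using D fin by (metis card_Un_disjoint Diff_disjoint Diff_partition finite_Diff finite_subset)
      then have "m ^ card K \<le> p ^ card D * (1 - p) ^ card (K - D)"
        using assms by (auto simp: power_add intro!: mult_mono power_mono)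
      also have "\<dots> \<le> expec K p (\<lambda>B. of_bool (Q (A \<union> B)))"
        unfolding expec_def
        using member_le_sum[of D "Pow K" "\<lambda>D. p ^ card D * (1 - p) ^ card (K - D) * of_bool (Q (A \<union> D))"]
          D fin assms by auto
      finally show ?thesis using True eq by simp
    next
      case False
      then show ?thesis
        using eq assms pr_nonneg[of p K "\<lambda>B. Q (A \<union> B)"] by (simp only: pr_def) simp
    qed
  qed (use assms in auto)
  finally show ?thesis unfolding split .
qed

section \<open>Paths and clusters in the triangular lattice\<close>

type_synonym site = "int \<times> int"

fun adj :: "site \<Rightarrow> site \<Rightarrow> bool" where
  "adj (a, b) (c, d) \<longleftrightarrow>
     c = a + 1 \<and> d = b \<or> c = a - 1 \<and> d = b \<or> c = a \<and> d = b + 1 \<or> c = a \<and> d = b - 1 \<or>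
     c = a + 1 \<and> d = b - 1 \<or> c = a - 1 \<and> d = b + 1"

text \<open>The relation tests only the endpoint of each step, so \<open>u \<in> A\<close> is
  demanded separately; the empty path then counts only at sites of \<open>A\<close>.\<close>

definition con :: "site set \<Rightarrow> site \<Rightarrow> site \<Rightarrow> bool" where
  "con A u v \<longleftrightarrow> u \<in> A \<and> (\<lambda>a b. b \<in> A \<and> adj a b)\<^sup>*\<^sup>* u v"

lemma adj_sym: "adj u v \<Longrightarrow> adj v u"
  by (cases u; cases v) auto

lemma con_refl: "u \<in> A \<Longrightarrow> con A u u"
  by (simp add: con_def)

lemma con_step: "con A u v \<Longrightarrow> adj v w \<Longrightarrow> w \<in> A \<Longrightarrow> con A u w"
  unfolding con_def by (auto intro: rtranclp.rtrancl_into_rtrancl)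

lemma con_induct [consumes 1, case_names refl step]:
  assumes "con A u v" "u \<in> A \<Longrightarrow> P u"
    and "\<And>v w. con A u v \<Longrightarrow> P v \<Longrightarrow> adj v w \<Longrightarrow> w \<in> A \<Longrightarrow> P w"
  shows "P v"
proof -
  have "(\<lambda>a b. b \<in> A \<and> adj a b)\<^sup>*\<^sup>* u v" "u \<in> A"
    using assms(1) by (auto simp: con_def)
  then show ?thesis
    by (induction rule: rtranclp_induct) (use assms(2,3) in \<open>auto simp: con_def\<close>)
qed

lemma con_in: "con A u v \<Longrightarrow> u \<in> A \<and> v \<in> A"
  by (induction rule: con_induct) (auto simp: con_def)

lemma con_trans: "con A u v \<Longrightarrow> con A v w \<Longrightarrow> con A u w"
  unfolding con_def by auto

lemma con_sym: "con A u v \<Longrightarrow> con A v u"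
proof (induction rule: con_induct)
  case (step v w)
  then show ?case
    by (meson adj_sym con_in con_refl con_step con_trans)
qed (rule con_refl)

lemma con_mono: "con A u v \<Longrightarrow> A \<subseteq> B \<Longrightarrow> con B u v"
  by (induction rule: con_induct) (auto intro: con_refl con_step)

lemma con_image:
  assumes "\<And>u v. adj u v \<Longrightarrow> adj (\<pi> u) (\<pi> v)" "con A u v"
  shows "con (\<pi> ` A) (\<pi> u) (\<pi> v)"
  using assms(2) by (induction rule: con_induct) (auto intro: con_refl con_step assms(1))

text \<open>The path is cut after its last visit to \<open>C\<close>; \<open>y\<close> is the next
  site, so the rest avoids \<open>C\<close>.\<close>

lemma con_last_exit:
  assumes "con A u w" "u \<in> C" "w \<notin> C"
  shows "\<exists>c\<in>C. \<exists>y. con A u c \<and> adj c y \<and> con (A - C) y w"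
  using assms
proof (induction rule: con_induct)
  case (step v w)
  show ?case
  proof (cases "v \<in> C")
    case True
    with step show ?thesis by (blast intro: con_refl)
  next
    case False
    with step obtain c y where "c \<in> C" "con A u c" "adj c y" "con (A - C) y v" by blast
    with step show ?thesis by (blast intro: con_step)
  qed
qed simp

lemma con_first_exit:
  assumes "con A u w" "u \<in> D"
  shows "con (A \<inter> D) u w \<or> (\<exists>d y. con (A \<inter> D) u d \<and> adj d y \<and> y \<in> A - D)"
  using assms by (induction rule: con_induct) (blast intro: con_refl con_step)+

definition cluster :: "site set \<Rightarrow> site \<Rightarrow> site set" where
  "cluster A v = {w. con A v w}"

text \<open>Neighbours inside \<open>C\<close> are included; the outer boundary relative to a region
  \<open>S\<close> is written \<open>nb C - S\<close>.\<close>

definition nb :: "site set \<Rightarrow> site set" where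
  "nb C = {y. \<exists>c\<in>C. adj c y}"

lemma cluster_subset: "cluster A v \<subseteq> A"
  by (auto simp: cluster_def dest: con_in)

lemma cluster_eq_iff:
  assumes "u \<in> A"
  shows "cluster A u = cluster A v \<longleftrightarrow> con A u v"
proof
  assume "cluster A u = cluster A v"
  moreover have "u \<in> cluster A u" using assms by (simp add: cluster_def con_refl)
  ultimately show "con A u v" by (simp add: cluster_def con_sym)
next
  assume "con A u v"
  then show "cluster A u = cluster A v"
    unfolding cluster_def by (intro Collect_cong iffI) (blast intro: con_sym con_trans)+
qed

lemma cluster_mono: "A \<subseteq> B \<Longrightarrow> cluster A v \<subseteq> cluster B v"
  by (auto simp: cluster_def intro: con_mono)

lemma nb_mono: "C \<subseteq> D \<Longrightarrow> nb C \<subseteq> nb D"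
  by (auto simp: nb_def)

lemma nb_finite: "finite C \<Longrightarrow> finite (nb C)"
proof -
  assume "finite C"
  have "nb C \<subseteq> (\<Union>c\<in>C. (+) c ` {(1, 0), (-1, 0), (0, 1), (0, -1), (1, -1), (-1, 1)})"
  proof
    fix y assume "y \<in> nb C"
    then obtain c where "c \<in> C" "adj c y" by (auto simp: nb_def)
    then have "y - c \<in> {(1, 0), (-1, 0), (0, 1), (0, -1), (1, -1), (-1, 1)}"
      by (cases c; cases y) auto
    moreover have "y = c + (y - c)" by simp
    ultimately show "y \<in> (\<Union>c\<in>C. (+) c ` {(1, 0), (-1, 0), (0, 1), (0, -1), (1, -1), (-1, 1)})"
      using \<open>c \<in> C\<close> by blast
  qed
  then show ?thesis
    by (rule finite_subset) (use \<open>finite C\<close> in auto)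
qed

text \<open>To recognise \<open>C\<close> as the cluster it is enough to see that \<open>C\<close>
  is open and connected and that its other neighbours are closed. This makes the event independent
  of all remaining sites.\<close>

lemma cluster_local:
  assumes "v \<in> C"
  shows "cluster A v = C \<longleftrightarrow> cluster (A \<inter> (C \<union> nb C)) v = C"
proof
  assume C: "cluster A v = C"
  have "con (A \<inter> (C \<union> nb C)) v w" if "con A v w" for w
    using that
  proof (induction rule: con_induct)
    case refl
    then show ?case using assms by (intro con_refl) auto
  next
    case (step u w)
    have "w \<in> C" using step C con_step[of A v u w] by (auto simp: cluster_def)
    with step show ?case by (intro con_step[of _ v u w]) auto
  qed
  then show "cluster (A \<inter> (C \<union> nb C)) v = C"
    using C by (auto simp: cluster_def intro: con_mono)
next
  assume C: "cluster (A \<inter> (C \<union> nb C)) v = C"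
  have "con (A \<inter> (C \<union> nb C)) v w" if "con A v w" for w
    using that
  proof (induction rule: con_induct)
    case refl
    then show ?case using assms by (intro con_refl) auto
  next
    case (step u w)
    then have "u \<in> C" using C by (auto simp: cluster_def)
    with step have "w \<in> nb C" by (auto simp: nb_def)
    with step show ?case by (intro con_step[of _ v u w]) auto
  qed
  then show "cluster A v = C"
    using C by (auto simp: cluster_def intro: con_mono)
qed

section \<open>Boxes, their rims, and one-arm events\<close>

definition block :: "nat \<Rightarrow> site set" where
  "block n = {- int n..int n} \<times> {- int n..int n}"

definition rim :: "nat \<Rightarrow> site set" where
  "rim n = {v \<in> block n. \<bar>fst v\<bar> = int n \<or> \<bar>snd v\<bar> = int n}"

abbreviation shift :: "site \<Rightarrow> site set \<Rightarrow> site set" where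
  "shift c A \<equiv> (+) c ` A"

lemma finite_block [simp]: "finite (block n)"
  by (simp add: block_def)

lemma rim_subset: "rim n \<subseteq> block n"
  by (auto simp: rim_def)

lemma finite_rim [simp]: "finite (rim n)"
  using finite_subset[OF rim_subset] by simp

lemma mem_shift: "v \<in> shift c A \<longleftrightarrow> v - c \<in> A"
proof
  assume "v - c \<in> A"
  then have "c + (v - c) \<in> shift c A" by (rule imageI)
  then show "v \<in> shift c A" by simp
qed auto

lemma mem_shift_block: "v \<in> shift c (block n) \<longleftrightarrow> \<bar>fst v - fst c\<bar> \<le> int n \<and> \<bar>snd v - snd c\<bar> \<le> int n"
  unfolding mem_shift by (auto simp: block_def mem_Times_iff abs_le_iff)

lemma mem_shift_rim:
  "v \<in> shift c (rim n) \<longleftrightarrow> v \<in> shift c (block n) \<and> (\<bar>fst v - fst c\<bar> = int n \<or> \<bar>snd v - snd c\<bar> = int n)"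
  unfolding mem_shift by (auto simp: rim_def)

lemma mem_block: "v \<in> block n \<longleftrightarrow> \<bar>fst v\<bar> \<le> int n \<and> \<bar>snd v\<bar> \<le> int n"
  by (auto simp: block_def mem_Times_iff abs_le_iff)

lemma mem_rim: "v \<in> rim n \<longleftrightarrow> v \<in> block n \<and> (\<bar>fst v\<bar> = int n \<or> \<bar>snd v\<bar> = int n)"
  by (auto simp: rim_def)

lemma adj_shift: "adj u v \<Longrightarrow> adj (c + u) (c + v)"
  by (cases c; cases u; cases v) auto

lemma adj_bounds: "adj u v \<Longrightarrow> \<bar>fst v - fst u\<bar> \<le> 1 \<and> \<bar>snd v - snd u\<bar> \<le> 1"
  by (cases u; cases v) auto

lemma con_shift: "con (shift c A) (c + u) (c + v) \<longleftrightarrow> con A u v"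
proof
  assume "con A u v"
  then show "con (shift c A) (c + u) (c + v)"
    by (rule con_image[where \<pi> = "(+) c", rotated]) (rule adj_shift)
next
  assume "con (shift c A) (c + u) (c + v)"
  then have "con (shift (- c) (shift c A)) (- c + (c + u)) (- c + (c + v))"
    by (rule con_image[where \<pi> = "(+) (- c)", rotated]) (rule adj_shift)
  moreover have "shift (- c) (shift c A) = A"
    by (auto simp: image_image)
  ultimately show "con A u v"
    by (simp only: minus_add_cancel)
qed

text \<open>Coordinates change by at most 1 along an edge, so a path cannot leave the box without
  visiting its rim; stopped at the first rim site, it has stayed inside.\<close>

lemma con_rim:
  assumes "con A u w" "u \<in> shift c (block n)" "w \<notin> shift c (block n) \<or> w \<in> shift c (rim n)"
  shows "\<exists>w'\<in>shift c (rim n). con (A \<inter> shift c (block n)) u w'"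
proof (cases "u \<in> shift c (rim n)")
  case True
  with assms show ?thesis by (blast intro: con_refl dest: con_in)
next
  case False
  let ?D = "shift c (block n) - shift c (rim n)"
  have "u \<in> ?D" using False assms by blast
  from con_first_exit[OF assms(1) this] show ?thesis
  proof (elim disjE exE conjE)
    assume "con (A \<inter> ?D) u w"
    then show ?thesis using assms(3) con_in by blast
  next
    fix d y assume *: "con (A \<inter> ?D) u d" "adj d y" "y \<in> A - ?D"
    then have "d \<in> ?D" using con_in by blast
    then have "y \<in> shift c (block n)"
      using adj_bounds[OF *(2)] by (auto simp only: mem_shift_block mem_shift_rim Diff_iff)
    then have "y \<in> shift c (rim n)" "con (A \<inter> shift c (block n)) u y"
      using * by (auto intro: con_step con_mono)
    then show ?thesis by blast
  qed
qed

definition arm :: "site \<Rightarrow> nat \<Rightarrow> site set \<Rightarrow> bool" where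
  "arm c n A \<longleftrightarrow> (\<exists>w\<in>shift c (rim n). con (A \<inter> shift c (block n)) c w)"

lemma arm_mono: "arm c n A \<Longrightarrow> A \<inter> shift c (block n) \<subseteq> B \<Longrightarrow> arm c n B"
  unfolding arm_def by (meson con_mono Int_subset_iff inf_le2)

lemma armI:
  assumes "con A c w" "w \<notin> shift c (block n) \<or> w \<in> shift c (rim n)"
  shows "arm c n A"
  unfolding arm_def using assms by (intro con_rim) (auto simp: mem_shift_block)

lemma arm_antimono:
  assumes "arm c m A" "n \<le> m"
  shows "arm c n A"
proof -
  obtain w where "w \<in> shift c (rim m)" "con (A \<inter> shift c (block m)) c w"
    using assms unfolding arm_def by blast
  with assms(2) show ?thesis
    by (intro armI[of A c w]) (auto intro: con_mono simp only: mem_shift_rim mem_shift_block)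
qed

definition theta :: "nat \<Rightarrow> real \<Rightarrow> real" where
  "theta n p = pr (block n) p (arm 0 n)"

lemma arm_shift: "arm c n (shift c A) \<longleftrightarrow> arm 0 n A"
proof -
  have "shift c A \<inter> shift c (block n) = shift c (A \<inter> block n)"
    by (simp add: image_Int)
  then show ?thesis
    using con_shift[of c "A \<inter> block n" 0] by (simp add: arm_def image_def[of "(+) 0"])
qed

lemma pr_shift: "finite V \<Longrightarrow> pr (shift c V) p Q = pr V p (\<lambda>A. Q (shift c A))"
  unfolding pr_def by (intro expec_image) auto

lemma pr_local:
  assumes "finite V" "W \<subseteq> V" "\<And>A. A \<subseteq> V \<Longrightarrow> Q A = Q (A \<inter> W)"
  shows "pr V p Q = pr W p Q"
  unfolding pr_def using assms by (intro expec_local) auto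

lemma arm_local: "arm c n A \<longleftrightarrow> arm c n (A \<inter> shift c (block n))"
  by (simp add: arm_def Int_assoc)

lemma pr_arm:
  assumes "finite V" "shift c (block n) \<subseteq> V"
  shows "pr V p (arm c n) = theta n p"
proof -
  have "pr V p (arm c n) = pr (shift c (block n)) p (arm c n)"
    using assms arm_local by (intro pr_local) auto
  then show ?thesis
    by (simp add: pr_shift arm_shift theta_def)
qed

lemma theta_nonneg: "0 \<le> p \<Longrightarrow> p \<le> 1 \<Longrightarrow> 0 \<le> theta n p"
  by (simp add: theta_def pr_nonneg)

lemma theta_le_1: "0 \<le> p \<Longrightarrow> p \<le> 1 \<Longrightarrow> theta n p \<le> 1"
  by (simp add: theta_def pr_le_1)

lemma block_mono: "m \<le> n \<Longrightarrow> block m \<subseteq> block n"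
  by (auto simp: mem_block)

lemma theta_antimono:
  assumes "0 \<le> p" "p \<le> 1" "m \<le> n"
  shows "theta n p \<le> theta m p"
proof -
  have "pr (block n) p (arm 0 n) \<le> pr (block n) p (arm 0 m)"
    using assms by (intro pr_mono) (auto intro: arm_antimono)
  also have "\<dots> = theta m p"
    using block_mono[OF assms(3)] by (intro pr_arm) (auto simp: image_def)
  finally show ?thesis by (simp add: theta_def)
qed

lemma pr_mono_p:
  assumes "finite V" "\<And>A B. A \<subseteq> B \<Longrightarrow> Q A \<Longrightarrow> Q B" "0 \<le> p" "p \<le> q" "q \<le> 1"
  shows "pr V p Q \<le> pr V q Q"
  unfolding pr_def using assms by (intro expec_mono_p monoI) auto

lemma theta_mono: "0 \<le> p \<Longrightarrow> p \<le> q \<Longrightarrow> q \<le> 1 \<Longrightarrow> theta n p \<le> theta n q"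
  unfolding theta_def by (intro pr_mono_p) (auto intro: arm_mono)

section \<open>Crossings of rectangles\<close>

lemma odd_changes:
  fixes g :: "nat \<Rightarrow> bool"
  shows "odd (\<Sum>i<m. of_bool (g i \<noteq> g (Suc i)) :: nat) \<longleftrightarrow> g 0 \<noteq> g m"
proof (induction m)
  case (Suc m)
  then show ?case
    by (simp only: sum.lessThan_Suc even_add) (auto simp del: sum_of_bool_eq)
qed simp

text \<open>The Hex lemma, by a parity count in the style of Sperner's lemma. Sites are labelled \<open>a\<close> if
  they are open and connected to the left side, and \<open>c\<close> if they are closed and connected to the
  bottom side; every triangle has an even number of edges joining an \<open>a\<close> to a \<open>c\<close>, so the number of
  such edges on the boundary of the rectangle is even. Without a crossing it would be odd.\<close>

lemma hex_exists:
  fixes x y :: int and k l :: nat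
  defines "R \<equiv> {x..x + int k} \<times> {y..y + int l}"
  shows "(\<exists>u w. con (A \<inter> R) u w \<and> fst u = x \<and> fst w = x + int k) \<or>
         (\<exists>u w. con (R - A) u w \<and> snd u = y \<and> snd w = y + int l)"
proof (rule ccontr)
  assume contra: "\<not> ?thesis"
  define a where "a v \<longleftrightarrow> (\<exists>u. con (A \<inter> R) u v \<and> fst u = x)" for v
  define c where "c v \<longleftrightarrow> (\<exists>u. con (R - A) u v \<and> snd u = y)" for v
  define h where "h u v \<longleftrightarrow> a u \<and> c v \<or> c u \<and> a v" for u v
  have a_open: "v \<in> A \<inter> R" if "a v" for v
    using that unfolding a_def by (blast dest: con_in)
  have c_closed: "v \<in> R - A" if "c v" for v
    using that unfolding c_def by (blast dest: con_in)
  have a_step: "a w" if "a v" "adj v w" "w \<in> A" "w \<in> R" for v w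
    using that con_step[of "A \<inter> R" _ v w] by (auto simp: a_def)
  have c_step: "c w" if "c v" "adj v w" "w \<notin> A" "w \<in> R" for v w
    using that con_step[of "R - A" _ v w] by (auto simp: c_def)
  have a_left: "a v" if "fst v = x" "v \<in> A" "v \<in> R" for v
    using that con_refl[of v "A \<inter> R"] unfolding a_def by blast
  have c_bottom: "c v" if "snd v = y" "v \<notin> A" "v \<in> R" for v
    using that con_refl[of v "R - A"] unfolding c_def by blast
  have a_right: "\<not> a v" if "fst v = x + int k" for v
    using that contra unfolding a_def by blast
  have c_top: "\<not> c v" if "snd v = y + int l" for v
    using that contra unfolding c_def by blast
  have h_sym: "h u v \<longleftrightarrow> h v u" for u v
    by (auto simp: h_def)
  \<comment> \<open>If one edge joins an \<open>a\<close> to a \<open>c\<close>, the third site gets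
    a label too: \<open>a\<close> if open, by its neighbour \<open>a\<close>, and \<open>c\<close>
    if closed, by its neighbour \<open>c\<close>. Then exactly one of the two other edges joins an
    \<open>a\<close> to a \<open>c\<close>.\<close>
  have triangle: "h u w \<longleftrightarrow> h u v \<noteq> h v w"
    if "adj u v" "adj v w" "adj u w" "u \<in> R" "v \<in> R" "w \<in> R" for u v w
    using that a_open c_closed a_step c_step adj_sym unfolding h_def by blast
  let ?p = "\<lambda>i j. (x + int i, y + int j)"
  define H :: "nat \<Rightarrow> nat \<Rightarrow> nat" where "H i j = of_bool (h (?p i j) (?p (Suc i) j))" for i j
  define W :: "nat \<Rightarrow> nat \<Rightarrow> nat" where "W i j = of_bool (h (?p i j) (?p i (Suc j)))" for i j
  \<comment> \<open>The diagonal cuts the square into two triangles; it is counted twice and drops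
    out modulo 2.\<close>
  have square: "even (H i j + H i (Suc j) + W i j + W (Suc i) j)" if "i < k" "j < l" for i j
  proof -
    have "h (?p i (Suc j)) (?p (Suc i) j) \<longleftrightarrow> h (?p i (Suc j)) (?p i j) \<noteq> h (?p i j) (?p (Suc i) j)"
      using that by (intro triangle) (auto simp: R_def)
    moreover have "h (?p i (Suc j)) (?p (Suc i) j) \<longleftrightarrow>
        h (?p i (Suc j)) (?p (Suc i) (Suc j)) \<noteq> h (?p (Suc i) (Suc j)) (?p (Suc i) j)"
      using that by (intro triangle) (auto simp: R_def)
    ultimately show ?thesis
      using h_sym[of "?p i (Suc j)" "?p i j"] h_sym[of "?p (Suc i) (Suc j)" "?p (Suc i) j"]
      by (simp only: even_add H_def W_def odd_of_bool_self[symmetric]) auto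
  qed
  have row: "even ((\<Sum>i<k'. H i j) + (\<Sum>i<k'. H i (Suc j)) + W 0 j + W k' j)"
    if "k' \<le> k" "j < l" for k' j
    using that(1)
  proof (induction k')
    case (Suc i)
    then show ?case
      using square[of i j] that(2) by (simp only: even_add sum.lessThan_Suc Suc_le_eq less_imp_le simp_thms) blast
  qed simp
  have total: "even ((\<Sum>i<k. H i 0) + (\<Sum>i<k. H i l') + (\<Sum>j<l'. W 0 j) + (\<Sum>j<l'. W k j))"
    if "l' \<le> l" for l'
    using that
  proof (induction l')
    case (Suc j)
    then show ?case
      using row[of k j] by (simp only: even_add sum.lessThan_Suc Suc_le_eq less_imp_le simp_thms) blast
  qed simp
  have "H i l = 0" if "i < k" for i
    using c_top by (auto simp: h_def H_def)
  moreover have "W k j = 0" for j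
    using a_right by (auto simp: h_def W_def)
  ultimately have "even ((\<Sum>i<k. H i 0) + (\<Sum>j<l. W 0 j))"
    using total[of l] by simp
  moreover have "odd (\<Sum>i<k. H i 0) \<longleftrightarrow> a (?p 0 0)"
  proof -
    \<comment> \<open>On the bottom row, a neighbour of an \<open>a\<close> that is not
      \<open>a\<close> itself must be closed, hence is a \<open>c\<close>.\<close>
    have "h (?p i 0) (?p (Suc i) 0) \<longleftrightarrow> a (?p i 0) \<noteq> a (?p (Suc i) 0)" if "i < k" for i
    proof -
      have "adj (?p i 0) (?p (Suc i) 0)" "?p i 0 \<in> R" "?p (Suc i) 0 \<in> R"
        using that by (auto simp: R_def)
      then show ?thesis
        unfolding h_def using a_step c_bottom a_open c_closed adj_sym
        by (metis DiffE IntE of_nat_0 add.right_neutral snd_conv)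
    qed
    then have "(\<Sum>i<k. H i 0) = (\<Sum>i<k. of_bool (a (?p i 0) \<noteq> a (?p (Suc i) 0)))"
      unfolding H_def by (intro sum.cong) auto
    then show ?thesis
      using odd_changes[of "\<lambda>i. a (?p i 0)" k] a_right[of "?p k 0"] by (simp del: sum_of_bool_eq)
  qed
  moreover have "odd (\<Sum>j<l. W 0 j) \<longleftrightarrow> c (?p 0 0)"
  proof -
    have "h (?p 0 j) (?p 0 (Suc j)) \<longleftrightarrow> c (?p 0 j) \<noteq> c (?p 0 (Suc j))" if "j < l" for j
    proof -
      have "adj (?p 0 j) (?p 0 (Suc j))" "?p 0 j \<in> R" "?p 0 (Suc j) \<in> R"
        using that by (auto simp: R_def)
      then show ?thesis
        unfolding h_def using c_step a_left a_open c_closed adj_sym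
        by (metis DiffE IntE of_nat_0 add.right_neutral fst_conv)
    qed
    then have "(\<Sum>j<l. W 0 j) = (\<Sum>j<l. of_bool (c (?p 0 j) \<noteq> c (?p 0 (Suc j))))"
      unfolding W_def by (intro sum.cong) auto
    then show ?thesis
      using odd_changes[of "\<lambda>j. c (?p 0 j)" l] c_top[of "?p 0 l"] by (simp del: sum_of_bool_eq)
  qed
  \<comment> \<open>The corner lies on both the left and the bottom side, so it carries exactly one
    label; this makes the boundary count odd.\<close>
  moreover have "a (?p 0 0) \<noteq> c (?p 0 0)"
  proof -
    have "?p 0 0 \<in> R" "fst (?p 0 0) = x" "snd (?p 0 0) = y"
      by (auto simp: R_def)
    then show ?thesis
      using a_left c_bottom a_open c_closed by blast
  qed
  ultimately show False by auto
qed

section \<open>Crossings in transversal directions intersect\<close>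

lemma con_imp_walk:
  assumes "con A u w"
  shows "\<exists>q (m :: nat). q 0 = u \<and> q m = w \<and> (\<forall>i\<le>m. q i \<in> A) \<and> (\<forall>i<m. adj (q i) (q (Suc i)))"
  using assms
proof (induction rule: con_induct)
  case refl
  then show ?case by (intro exI[of _ "\<lambda>_. u"] exI[of _ 0]) simp
next
  case (step v w)
  then obtain q and m :: nat where q: "q 0 = u" "q m = v" "\<forall>i\<le>m. q i \<in> A"
    "\<forall>i<m. adj (q i) (q (Suc i))" by blast
  show ?case
    by (intro exI[of _ "q(Suc m := w)"] exI[of _ "Suc m"])
      (use q step in \<open>auto simp: less_Suc_eq le_Suc_eq\<close>)
qed

text \<open>The parity of the number of edges of a walk that leave the row of \<open>v\<close> upwards to the right of
  \<open>v\<close> tells on which side of the walk \<open>v\<close> lies.\<close>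

definition crosses :: "site \<Rightarrow> site \<Rightarrow> site \<Rightarrow> bool" where
  "crosses v a b \<longleftrightarrow> snd a = snd v \<and> snd b = snd v + 1 \<and> fst v < fst a \<or>
                   snd b = snd v \<and> snd a = snd v + 1 \<and> fst v < fst b"

text \<open>Moving the base point one step to the right can only affect edges at the new base point,
  which the walk avoids.\<close>

lemma crosses_row:
  assumes "a \<noteq> (i + 1, j)" "b \<noteq> (i + 1, j)"
  shows "crosses (i, j) a b \<longleftrightarrow> crosses (i + 1, j) a b"
proof -
  obtain a1 a2 b1 b2 where ab: "a = (a1, a2)" "b = (b1, b2)"
    by (cases a; cases b)
  have "a2 = j \<Longrightarrow> a1 \<noteq> i + 1" "b2 = j \<Longrightarrow> b1 \<noteq> i + 1"
    using assms by (auto simp: ab)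
  then show ?thesis
    unfolding crosses_def ab fst_conv snd_conv by smt
qed

text \<open>The edges counted for exactly one of the two base points are those that enter or leave
  \<open>U\<close>, the ray to the right of the upper one. A walk that begins and ends off
  \<open>U\<close> has an even number of them.\<close>

lemma crosses_up:
  fixes i j i' :: int
  assumes "adj a b" "a \<noteq> (i, j)" "b \<noteq> (i, j)" "a \<noteq> (i', j + 1)" "b \<noteq> (i', j + 1)" "i' = i \<or> i' = i - 1"
  defines "U \<equiv> {u. snd u = j + 1 \<and> i' < fst u}"
  shows "crosses (i, j) a b \<noteq> crosses (i', j + 1) a b \<longleftrightarrow> (a \<in> U) \<noteq> (b \<in> U)"
proof -
  obtain a1 a2 b1 b2 where ab: "a = (a1, a2)" "b = (b1, b2)"
    by (cases a; cases b)
  have "b1 = a1 + 1 \<and> b2 = a2 \<or> b1 = a1 - 1 \<and> b2 = a2 \<or> b1 = a1 \<and> b2 = a2 + 1 \<or>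
      b1 = a1 \<and> b2 = a2 - 1 \<or> b1 = a1 + 1 \<and> b2 = a2 - 1 \<or> b1 = a1 - 1 \<and> b2 = a2 + 1"
    using assms(1) by (simp add: ab)
  moreover have "a2 = j + 1 \<Longrightarrow> a1 \<noteq> i'" "a2 = j \<Longrightarrow> a1 \<noteq> i" "b2 = j + 1 \<Longrightarrow> b1 \<noteq> i'" "b2 = j \<Longrightarrow> b1 \<noteq> i"
    using assms(2-5) by (auto simp: ab)
  ultimately show ?thesis
    using assms(6) unfolding crosses_def U_def ab mem_Collect_eq fst_conv snd_conv by smt
qed

lemma crosses_right:
  assumes "a \<noteq> v" "b \<noteq> v" "adj a b" "fst v \<le> fst a" "fst v \<le> fst b"
  shows "crosses v a b \<longleftrightarrow> (a \<in> {u. snd v < snd u}) \<noteq> (b \<in> {u. snd v < snd u})"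
proof -
  obtain i j a1 a2 b1 b2 where ab: "v = (i, j)" "a = (a1, a2)" "b = (b1, b2)"
    by (cases v; cases a; cases b)
  have "\<bar>b2 - a2\<bar> \<le> 1"
    using adj_bounds[OF assms(3)] by (simp add: ab)
  moreover have "a2 = j \<Longrightarrow> a1 \<noteq> i" "b2 = j \<Longrightarrow> b1 \<noteq> i"
    using assms(1,2) by (auto simp: ab)
  ultimately show ?thesis
    using assms(4,5) unfolding crosses_def ab mem_Collect_eq fst_conv snd_conv by smt
qed

text \<open>A discrete Jordan curve argument: if \<open>A\<close> avoided the walk through
  \<open>B\<close>, the parity \<open>S\<close> would be constant along the path in
  \<open>A\<close>, but it is odd to the left of the walk and even to the right.\<close>

lemma crossings_meet:
  fixes A B :: "site set"
  assumes "con A u w" "\<And>v. v \<in> A \<Longrightarrow> y1 \<le> snd v \<and> snd v \<le> y2" "fst u \<le> x1" "x2 \<le> fst w"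
    and "con B s t" "\<And>v. v \<in> B \<Longrightarrow> x1 \<le> fst v \<and> fst v \<le> x2" "snd s \<le> y1" "y2 \<le> snd t"
  shows "A \<inter> B \<noteq> {}"
proof
  assume disj: "A \<inter> B = {}"
  \<comment> \<open>The walk is prolonged by one site at each end, so that its ends lie strictly
    below and strictly above all rows of \<open>A\<close>.\<close>
  define s' t' where "s' = (fst s, snd s - 1)" and "t' = (fst t, snd t + 1)"
  define B' where "B' = insert s' (insert t' B)"
  have adj: "adj s' s" "adj t t'"
    unfolding s'_def t'_def by (cases s, simp) (cases t, simp)
  have st: "s \<in> B" "t \<in> B" using con_in[OF assms(5)] by auto
  have "con B' s' s"
    by (rule con_step[OF con_refl adj(1)]) (use st in \<open>auto simp: B'_def\<close>)
  moreover have "con B' s t"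
    using con_mono[OF assms(5), of B'] by (auto simp: B'_def)
  ultimately have "con B' s t" "con B' s' t"
    using con_trans by blast+
  then have "con B' s' t'"
    using con_step[OF _ adj(2)] by (auto simp: B'_def)
  then obtain q and m :: nat where q: "q 0 = s'" "q m = t'" "\<And>i. i \<le> m \<Longrightarrow> q i \<in> B'"
    "\<And>i. i < m \<Longrightarrow> adj (q i) (q (Suc i))"
    using con_imp_walk[of B' s' t'] by blast
  have rows: "snd s' < y1" "y2 < snd t'"
    using assms(7,8) by (auto simp: s'_def t'_def)
  have cols: "x1 \<le> fst v \<and> fst v \<le> x2" if "v \<in> B'" for v
    using that assms(6)[of s] assms(6)[of t] assms(6)[of v] st by (auto simp: B'_def s'_def t'_def)
  have "s' \<notin> A" "t' \<notin> A"
    using assms(2)[of s'] assms(2)[of t'] rows by auto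
  then have disj': "v \<notin> A" if "v \<in> B'" for v
    using that disj by (auto simp: B'_def)
  define S where "S v \<longleftrightarrow> odd (\<Sum>i<m. of_bool (crosses v (q i) (q (Suc i))) :: nat)" for v
  have avoid: "q i \<noteq> v" if "i \<le> m" "v \<in> A" for i v
    using disj' q that by metis
  have S_row: "S (i, j) \<longleftrightarrow> S (i + 1, j)" if "(i, j) \<in> A" "(i + 1, j) \<in> A" for i j
  proof -
    have "crosses (i, j) (q n) (q (Suc n)) \<longleftrightarrow> crosses (i + 1, j) (q n) (q (Suc n))" if "n < m" for n
      using that q avoid \<open>(i + 1, j) \<in> A\<close> by (intro crosses_row) auto
    then show ?thesis by (simp add: S_def del: sum_of_bool_eq)
  qed
  have S_up: "S (i, j) \<longleftrightarrow> S (i', j + 1)"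
    if "(i, j) \<in> A" "(i', j + 1) \<in> A" "i' = i \<or> i' = i - 1" for i j i'
  proof -
    let ?U = "{u. snd u = j + 1 \<and> i' < fst u}"
    have "crosses (i, j) (q n) (q (Suc n)) \<noteq> crosses (i', j + 1) (q n) (q (Suc n)) \<longleftrightarrow>
        (q n \<in> ?U) \<noteq> (q (Suc n) \<in> ?U)" if "n < m" for n
      using that q avoid \<open>(i, j) \<in> A\<close> \<open>(i', j + 1) \<in> A\<close> \<open>i' = i \<or> i' = i - 1\<close>
      by (intro crosses_up) auto
    then have "(\<Sum>n<m. of_bool (crosses (i, j) (q n) (q (Suc n)) \<noteq> crosses (i', j + 1) (q n) (q (Suc n))) :: nat) =
        (\<Sum>n<m. of_bool ((q n \<in> ?U) \<noteq> (q (Suc n) \<in> ?U)))"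
      by (intro sum.cong) auto
    moreover have "q 0 \<notin> ?U" "q m \<notin> ?U"
      using rows assms(2)[OF that(2)] q by auto
    ultimately have "even (\<Sum>n<m. of_bool (crosses (i, j) (q n) (q (Suc n)) \<noteq> crosses (i', j + 1) (q n) (q (Suc n))) :: nat)"
      using odd_changes[of "\<lambda>n. q n \<in> ?U" m] by (auto simp del: sum_of_bool_eq)
    moreover have "even (\<Sum>n<m'. of_bool (P n \<noteq> Q n) :: nat) \<longleftrightarrow>
        even (\<Sum>n<m'. of_bool (P n) :: nat) = even (\<Sum>n<m'. of_bool (Q n) :: nat)" for P Q and m' :: nat
    proof (induction m')
      case (Suc n)
      then show ?case
        by (simp only: sum.lessThan_Suc even_add) (auto simp del: sum_of_bool_eq)
    qed simp
    ultimately show ?thesis by (simp add: S_def del: sum_of_bool_eq)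
  qed
  have S_adj: "S v \<longleftrightarrow> S v'" if "adj v v'" "v \<in> A" "v' \<in> A" for v v'
  proof -
    obtain i j i' j' where "v = (i, j)" "v' = (i', j')" by (cases v; cases v')
    with that show ?thesis
      using S_row[of i j] S_row[of i' j'] S_up[of i j i'] S_up[of i' j' i] by auto
  qed
  have "S u \<longleftrightarrow> S w"
    using assms(1)
  proof (induction rule: con_induct)
    case (step v w)
    then show ?case using S_adj[of v w] con_in by blast
  qed simp
  moreover have "S u"
  proof -
    have u: "u \<in> A" using assms(1) con_in by blast
    let ?U = "{v. snd u < snd v}"
    have "crosses u (q n) (q (Suc n)) \<longleftrightarrow> (q n \<in> ?U) \<noteq> (q (Suc n) \<in> ?U)" if "n < m" for n
    proof -
      have le: "fst u \<le> fst (q i)" if "i \<le> m" for i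
        using cols[OF q(3)[OF that]] assms(3) by simp
      show ?thesis
        using that u by (intro crosses_right avoid q le) auto
    qed
    then have "S u \<longleftrightarrow> odd (\<Sum>n<m. of_bool ((q n \<in> ?U) \<noteq> (q (Suc n) \<in> ?U)) :: nat)"
      by (simp add: S_def del: sum_of_bool_eq)
    then show ?thesis
      using odd_changes[of "\<lambda>n. q n \<in> ?U" m] q rows assms(2)[OF u] by (simp del: sum_of_bool_eq)
  qed
  moreover have "\<not> S w"
  proof -
    have "\<not> crosses w (q n) (q (Suc n))" if "n < m" for n
      using that q cols[of "q n"] cols[of "q (Suc n)"] assms(4) by (force simp: crosses_def)
    then show ?thesis by (simp add: S_def del: sum_of_bool_eq)
  qed
  ultimately show False by blast
qed

section \<open>Sharpness: the Duminil-Copin--Tassion argument\<close>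

lemma shift_0 [simp]: "shift 0 A = A"
  by simp

lemma arm_0: "arm 0 n A \<longleftrightarrow> (\<exists>w\<in>rim n. con (A \<inter> block n) 0 w)"
  unfolding arm_def shift_0 ..

lemma zero_in_block [simp]: "0 \<in> block n"
  by (simp add: mem_block)

lemma rim_step: "u \<in> block n \<Longrightarrow> u \<notin> rim n \<Longrightarrow> adj u v \<Longrightarrow> v \<in> block n"
  using adj_bounds[of u v] by (auto simp: mem_block mem_rim)

text \<open>No factor for the boundary site being open: in \<open>simon_inequality\<close> this
  belongs to the arm that starts there, and in \<open>pivotal_sum\<close> the boundary sites counted
  are closed. If the origin is closed, its cluster is empty and contributes 0.\<close>

definition phi :: "site set \<Rightarrow> real \<Rightarrow> real" where
  "phi S p = expec S p (\<lambda>A. real (card (nb (cluster A 0) - S)))"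

lemma phi_mono:
  assumes "finite S" "0 \<le> p" "p \<le> q" "q \<le> 1"
  shows "phi S p \<le> phi S q"
proof -
  let ?f = "\<lambda>A. real (card (nb (cluster (A \<inter> S) 0) - S))"
  have "mono ?f"
  proof (intro monoI of_nat_mono card_mono)
    fix A B :: "site set" assume "A \<subseteq> B"
    then show "nb (cluster (A \<inter> S) 0) - S \<subseteq> nb (cluster (B \<inter> S) 0) - S"
      by (intro Diff_mono nb_mono cluster_mono) auto
    have "finite (cluster (B \<inter> S) 0)"
      using cluster_subset assms(1) by (metis finite_Int finite_subset)
    then show "finite (nb (cluster (B \<inter> S) 0) - S)"
      by (intro finite_Diff nb_finite)
  qed
  then have "expec S p ?f \<le> expec S q ?f"
    using assms by (intro expec_mono_p)
  moreover have "phi S r = expec S r ?f" for r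
    unfolding phi_def by (intro expec_cong) (simp add: Int_absorb2)
  ultimately show ?thesis by simp
qed

text \<open>The path is cut at its last visit to \<open>C\<close>. Afterwards it uses no site that
  has to be examined to determine \<open>C\<close>, because an open site of \<open>S\<close> next to
  \<open>C\<close> belongs to \<open>C\<close>. The extra 1 in the radius is the step from
  \<open>block L\<close> to \<open>y\<close>.\<close>

lemma arm_decompose:
  assumes "arm 0 (m + L + 1) A" "0 \<in> S" "S \<subseteq> block L"
  defines "C \<equiv> cluster (A \<inter> S) 0"
  shows "0 \<in> C \<and> (\<exists>y\<in>nb C - S. arm y m (A - S \<inter> (C \<union> nb C)))"
proof -
  obtain w where w: "w \<in> rim (m + L + 1)" "con A 0 w"
    using assms(1) unfolding arm_0 by (meson con_mono inf_le1)
  have "0 \<in> A" using w con_in by blast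
  then have 0: "0 \<in> C"
    using assms(2) by (simp add: C_def cluster_def con_refl)
  have C: "C \<subseteq> block L"
    using cluster_subset assms(3) unfolding C_def by blast
  have "w \<notin> C"
    using w C by (auto simp: mem_block mem_rim)
  from con_last_exit[OF w(2) 0 this] obtain c y where
    cy: "c \<in> C" "adj c y" "con (A - C) y w" by blast
  have y: "y \<in> A - C" using cy con_in by blast
  have closed: "x \<in> C" if "d \<in> C" "adj d x" "x \<in> A \<inter> S" for d x
    using that con_step by (auto simp: C_def cluster_def)
  have "y \<notin> S" using closed cy y by blast
  have "A - C \<subseteq> A - S \<inter> (C \<union> nb C)"
    using closed by (auto simp: nb_def)
  then have con: "con (A - S \<inter> (C \<union> nb C)) y w"
    using cy con_mono by blast
  have "c \<in> block L" using cy C by blast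
  then have "w \<notin> shift y (block m) \<or> w \<in> shift y (rim m)"
  proof -
    have "\<bar>fst y\<bar> \<le> int L + 1" "\<bar>snd y\<bar> \<le> int L + 1"
      using \<open>c \<in> block L\<close> adj_bounds[OF cy(2)] unfolding mem_block by linarith+
    moreover have "\<bar>fst w\<bar> = int (m + L + 1) \<or> \<bar>snd w\<bar> = int (m + L + 1)"
      using w(1) by (simp add: mem_rim)
    ultimately have "int m \<le> \<bar>fst w - fst y\<bar> \<or> int m \<le> \<bar>snd w - snd y\<bar>"
      by linarith
    then show ?thesis
      unfolding mem_shift_rim mem_shift_block by linarith
  qed
  then have "arm y m (A - S \<inter> (C \<union> nb C))"
    by (rule armI[OF con])
  moreover have "y \<in> nb C - S"
    using cy \<open>y \<notin> S\<close> by (auto simp: nb_def)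
  ultimately show ?thesis using 0 by blast
qed

text \<open>Sum over the possible clusters \<open>C\<close> of the origin in \<open>S\<close>. That
  \<open>C\<close> is the cluster depends only on \<open>X C\<close>, and the remaining arm from
  \<open>y\<close> avoids \<open>X C\<close>; the two are independent, and the arm has probability
  at most \<open>theta m p\<close>.\<close>

lemma simon_inequality:
  assumes "0 \<in> S" "S \<subseteq> block L" "0 \<le> p" "p \<le> 1"
  shows "theta (m + L + 1) p \<le> phi S p * theta m p"
proof -
  define V where "V = block (m + L + 1)"
  define X where "X C = S \<inter> (C \<union> nb C)" for C
  define K where "K = {C \<in> Pow S. 0 \<in> C}"
  define E where "E C A = (of_bool (cluster (A \<inter> S) 0 = C) :: real)" for C A
  define F where "F C A = (\<Sum>y\<in>nb C - S. of_bool (arm y m (A - X C)) :: real)" for C A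
  have finV: "finite V" and SV: "S \<subseteq> V"
    using assms(2) block_mono[of L "m + L + 1"] by (auto simp: V_def)
  then have finS: "finite S" by (auto dest: finite_subset)
  have finK: "finite K" using finS by (simp add: K_def)
  have finC: "finite (nb C - S)" if "C \<in> K" for C
    using that finS by (intro finite_Diff nb_finite) (auto simp: K_def dest: finite_subset)
  have "of_bool (arm 0 (m + L + 1) A) \<le> (\<Sum>C\<in>K. E C A * F C A)" for A
  proof (cases "arm 0 (m + L + 1) A")
    case True
    define C where "C = cluster (A \<inter> S) 0"
    obtain y where y: "0 \<in> C" "y \<in> nb C - S" "arm y m (A - X C)"
      using arm_decompose[OF True assms(1,2)] by (auto simp: C_def X_def)
    then have "C \<in> K"
      using cluster_subset[of "A \<inter> S" 0] unfolding K_def C_def by blast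
    have "1 \<le> F C A"
      using member_le_sum[of y "nb C - S" "\<lambda>y. of_bool (arm y m (A - X C)) :: real"] y finC[OF \<open>C \<in> K\<close>]
      by (simp add: F_def del: sum_of_bool_eq)
    then have "1 \<le> E C A * F C A" by (simp add: E_def C_def)
    also have "\<dots> \<le> (\<Sum>C\<in>K. E C A * F C A)"
      using \<open>C \<in> K\<close> finK by (intro member_le_sum) (auto simp: E_def F_def intro!: sum_nonneg)
    finally show ?thesis by simp
  qed (auto simp: E_def F_def intro!: sum_nonneg mult_nonneg_nonneg)
  then have "theta (m + L + 1) p \<le> expec V p (\<lambda>A. \<Sum>C\<in>K. E C A * F C A)"
    unfolding theta_def pr_def V_def using assms by (intro expec_mono)
  also have "\<dots> = (\<Sum>C\<in>K. expec V p (\<lambda>A. E C A * F C A))"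
    by (rule expec_sum)
  also have "\<dots> \<le> (\<Sum>C\<in>K. theta m p * (expec V p (E C) * real (card (nb C - S))))"
  proof (rule sum_mono)
    fix C assume C: "C \<in> K"
    then have C0: "0 \<in> C" "C \<subseteq> S" by (auto simp: K_def)
    have "E C A = E C (A \<inter> X C)" for A
    proof -
      have "cluster (A \<inter> S) 0 = C \<longleftrightarrow> cluster (A \<inter> S \<inter> (C \<union> nb C)) 0 = C"
        using C0(1) by (rule cluster_local)
      moreover have "cluster (A \<inter> X C \<inter> S) 0 = C \<longleftrightarrow> cluster (A \<inter> X C \<inter> S \<inter> (C \<union> nb C)) 0 = C"
        using C0(1) by (rule cluster_local)
      moreover have "A \<inter> X C \<inter> S \<inter> (C \<union> nb C) = A \<inter> S \<inter> (C \<union> nb C)"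
        by (auto simp: X_def)
      ultimately show ?thesis by (simp add: E_def)
    qed
    moreover have "F C A = F C (A - X C)" for A
      by (simp add: F_def)
    ultimately have "expec V p (\<lambda>A. E C A * F C A) = expec V p (E C) * expec V p (F C)"
      using SV by (intro expec_indep[OF finV, of "X C"]) (auto simp: X_def)
    also have "\<dots> \<le> expec V p (E C) * (theta m p * real (card (nb C - S)))"
    proof (rule mult_left_mono)
      have "expec V p (F C) = (\<Sum>y\<in>nb C - S. pr V p (\<lambda>A. arm y m (A - X C)))"
        unfolding F_def pr_def by (rule expec_sum)
      also have "\<dots> \<le> (\<Sum>y\<in>nb C - S. theta m p)"
      proof (rule sum_mono)
        fix y assume "y \<in> nb C - S"
        then obtain c where "c \<in> block L" "adj c y"
          using C0 assms(2) by (auto simp: nb_def)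
        then have "\<bar>fst y\<bar> \<le> int L + 1" "\<bar>snd y\<bar> \<le> int L + 1"
          using adj_bounds[of c y] unfolding mem_block by linarith+
        then have "shift y (block m) \<subseteq> V"
          unfolding V_def subset_iff mem_block mem_shift_block by (intro allI impI) linarith
        then have "pr V p (arm y m) = theta m p"
          using finV by (intro pr_arm)
        moreover have "pr V p (\<lambda>A. arm y m (A - X C)) \<le> pr V p (arm y m)"
          using assms by (intro pr_mono) (auto intro: arm_mono)
        ultimately show "pr V p (\<lambda>A. arm y m (A - X C)) \<le> theta m p" by simp
      qed
      finally show "expec V p (F C) \<le> theta m p * real (card (nb C - S))"
        by (simp add: mult.commute)
    next
      show "0 \<le> expec V p (E C)"
        using expec_mono[OF assms(3,4), of V "\<lambda>_. 0" "E C"] finV by (simp add: E_def)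
    qed
    finally show "expec V p (\<lambda>A. E C A * F C A) \<le> theta m p * (expec V p (E C) * real (card (nb C - S)))"
      by (simp add: mult_ac)
  qed
  also have "\<dots> = theta m p * expec V p (\<lambda>A. \<Sum>C\<in>K. real (card (nb C - S)) * E C A)"
    unfolding expec_sum expec_cmult sum_distrib_left by (simp only: mult_ac)
  also have "expec V p (\<lambda>A. \<Sum>C\<in>K. real (card (nb C - S)) * E C A) =
      expec V p (\<lambda>A. real (card (nb (cluster (A \<inter> S) 0) - S)))"
  proof (rule expec_cong)
    fix A
    let ?D = "cluster (A \<inter> S) 0"
    have "(\<Sum>C\<in>K. real (card (nb C - S)) * E C A) =
        (\<Sum>C\<in>K. if C = ?D then real (card (nb C - S)) else 0)"
      by (intro sum.cong) (auto simp: E_def)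
    also have "\<dots> = (if ?D \<in> K then real (card (nb ?D - S)) else 0)"
      using finK by simp
    also have "\<dots> = real (card (nb ?D - S))"
    proof (cases "0 \<in> A")
      case True
      then have "?D \<in> K"
        using assms(1) cluster_subset[of "A \<inter> S"] by (auto simp: K_def cluster_def con_refl)
      then show ?thesis by simp
    next
      case False
      then have "?D = {}" by (auto simp: cluster_def dest: con_in)
      then show ?thesis by (simp add: nb_def)
    qed
    finally show "(\<Sum>C\<in>K. real (card (nb C - S)) * E C A) = real (card (nb ?D - S))" .
  qed
  also have "\<dots> = expec S p (\<lambda>A. real (card (nb (cluster (A \<inter> S) 0) - S)))"
    using finV SV by (intro expec_local) (auto simp: Int_assoc)
  also have "\<dots> = phi S p"
    unfolding phi_def by (intro expec_cong) (simp add: Int_absorb2)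
  finally show ?thesis by (simp add: mult.commute)
qed

definition tch :: "nat \<Rightarrow> site set \<Rightarrow> site set" where
  "tch n A = {v. \<exists>w\<in>rim n. con (A \<inter> block n) v w}"

lemma con_cluster:
  assumes "con A v w"
  shows "con (cluster A v) v w"
  using assms
proof (induction rule: con_induct)
  case (step u w)
  then show ?case
    using con_step by (intro con_step[of _ v u w]) (auto simp: cluster_def)
qed (auto simp: cluster_def intro: con_refl)

text \<open>Exploration from the rim examines exactly \<open>Y T\<close>. The equation
  \<open>A \<inter> Y T = T\<close> says at once that \<open>T\<close> is open and that the other
  examined sites are closed, so nothing is learned about the rest of the box.\<close>

lemma tch_local:
  assumes "A \<subseteq> block n"
  defines "Y \<equiv> \<lambda>T. (T \<union> nb T \<union> rim n) \<inter> block n"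
  shows "tch n A = T \<longleftrightarrow> T \<subseteq> block n \<and> tch n T = T \<and> A \<inter> Y T = T"
proof
  assume T: "tch n A = T"
  have "T \<subseteq> A \<inter> block n"
    using T by (auto simp: tch_def dest: con_in)
  have step: "v \<in> T" if uv: "con (A \<inter> block n) u v" and u: "u \<in> T" for u v
  proof -
    obtain w where "w \<in> rim n" "con (A \<inter> block n) u w"
      using u T by (auto simp: tch_def)
    then show ?thesis
      using uv T con_sym con_trans unfolding tch_def by blast
  qed
  have "A \<inter> Y T \<subseteq> T"
  proof
    fix x assume x: "x \<in> A \<inter> Y T"
    then have "con (A \<inter> block n) x x" by (intro con_refl) (auto simp: Y_def)
    moreover have "x \<in> T" if nb: "x \<in> nb T"
    proof -
      obtain t where t: "t \<in> T" "adj t x" using nb by (auto simp: nb_def)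
      then have "con (A \<inter> block n) t x"
        using \<open>T \<subseteq> A \<inter> block n\<close> x by (intro con_step[OF con_refl]) (auto simp: Y_def)
      then show ?thesis using step t by blast
    qed
    moreover have "x \<in> T" if "x \<in> rim n"
      using that T calculation(1) by (auto simp: tch_def)
    ultimately show "x \<in> T" using x by (auto simp: Y_def)
  qed
  moreover have "T \<subseteq> A \<inter> Y T"
    using \<open>T \<subseteq> A \<inter> block n\<close> by (auto simp: Y_def)
  moreover have "T \<subseteq> tch n T"
  proof
    fix v assume v: "v \<in> T"
    then obtain w where w: "w \<in> rim n" "con (A \<inter> block n) v w"
      using T by (auto simp: tch_def)
    then have "con (cluster (A \<inter> block n) v) v w" by (intro con_cluster)
    moreover have "cluster (A \<inter> block n) v \<subseteq> T \<inter> block n"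
      using step v \<open>T \<subseteq> A \<inter> block n\<close> unfolding cluster_def by blast
    ultimately show "v \<in> tch n T"
      using w(1) con_mono unfolding tch_def by blast
  qed
  moreover have "tch n T \<subseteq> T"
    by (auto simp: tch_def dest: con_in)
  ultimately show "T \<subseteq> block n \<and> tch n T = T \<and> A \<inter> Y T = T"
    using \<open>T \<subseteq> A \<inter> block n\<close> by blast
next
  assume T: "T \<subseteq> block n \<and> tch n T = T \<and> A \<inter> Y T = T"
  then have "T \<inter> block n \<subseteq> A \<inter> block n" by blast
  then have "tch n T \<subseteq> tch n A"
    unfolding tch_def using con_mono by blast
  moreover have "v \<in> T" if "con (A \<inter> block n) w v" "w \<in> rim n" for w v
    using that
  proof (induction rule: con_induct)
    case refl
    then show ?case using T by (auto simp: Y_def)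
  next
    case (step u v)
    then have "v \<in> A \<inter> Y T" by (auto simp: Y_def nb_def)
    then show ?case using T by simp
  qed
  then have "tch n A \<subseteq> T"
    unfolding tch_def using con_sym by blast
  ultimately show "tch n A = T" using T by blast
qed

text \<open>Duminil-Copin and Tassion's differential inequality: conditionally on the set \<open>T\<close> of sites
  connected to the rim, the cluster of the origin in the unexplored region \<open>S\<close> is adjacent to
  \<open>phi S p\<close> sites outside \<open>S\<close> on average, and all of them are pivotal.\<close>

lemma pivotal_sum:
  assumes "0 \<le> p" "p \<le> 1" "\<And>S. finite S \<Longrightarrow> 0 \<in> S \<Longrightarrow> 1 \<le> phi S p"
  shows "1 - theta n p \<le>
    (\<Sum>x\<in>block n. expec (block n) p (\<lambda>A. of_bool (arm 0 n (insert x A)) - of_bool (arm 0 n (A - {x}))))"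
proof -
  define V where "V = block n"
  define Y where "Y T = (T \<union> nb T \<union> rim n) \<inter> V" for T
  define \<T> where "\<T> = {T. T \<subseteq> V \<and> tch n T = T \<and> 0 \<notin> T}"
  define N where "N A = {x \<in> V. x \<notin> A \<and> arm 0 n (insert x A)}" for A
  have finV: "finite V" by (simp add: V_def)
  have finT: "finite \<T>"
    by (rule finite_subset[of _ "Pow V"]) (auto simp: \<T>_def finV)
  have tch: "arm 0 n A \<longleftrightarrow> 0 \<in> tch n A" for A
    by (simp add: arm_0 tch_def)
  have decomp: "of_bool (\<not> arm 0 n A) * r = (\<Sum>T\<in>\<T>. of_bool (A \<inter> Y T = T) * r)"
    if "A \<subseteq> V" for A and r :: real
  proof -
    have "A \<inter> Y T = T \<longleftrightarrow> T = tch n A" if "T \<in> \<T>" for T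
      using tch_local[of A n T] that \<open>A \<subseteq> V\<close> unfolding \<T>_def Y_def V_def by blast
    then have "(\<Sum>T\<in>\<T>. of_bool (A \<inter> Y T = T) * r) = (\<Sum>T\<in>\<T>. if T = tch n A then r else 0)"
      by (intro sum.cong) auto
    also have "\<dots> = (if tch n A \<in> \<T> then r else 0)"
      using finT by simp
    also have "tch n A \<in> \<T> \<longleftrightarrow> \<not> arm 0 n A"
      using tch_local[of A n "tch n A"] that by (auto simp: \<T>_def V_def tch)
    finally show ?thesis by simp
  qed
  have "1 - theta n p = expec V p (\<lambda>A. of_bool (\<not> arm 0 n A) * 1)"
    using pr_not[OF finV, of p "arm 0 n"] by (simp add: theta_def V_def pr_def)
  also have "\<dots> = expec V p (\<lambda>A. \<Sum>T\<in>\<T>. of_bool (A \<inter> Y T = T) * 1)"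
    using decomp by (rule expec_cong)
  also have "\<dots> = (\<Sum>T\<in>\<T>. pr V p (\<lambda>A. A \<inter> Y T = T))"
    by (simp only: expec_sum pr_def mult_1_right)
  also have "\<dots> \<le> (\<Sum>T\<in>\<T>. expec V p (\<lambda>A. of_bool (A \<inter> Y T = T) * real (card (N A))))"
  proof (rule sum_mono)
    fix T assume T: "T \<in> \<T>"
    define S where "S = V - Y T"
    \<comment> \<open>Default 1: an origin outside \<open>S\<close> is an examined closed site, and
      opening it alone creates the arm, so it counts as one pivotal site.\<close>
    define g where "g D = (if 0 \<in> S then real (card (nb (cluster D 0) - S)) else 1)" for D
    have SV: "S \<subseteq> V" "finite S" using finV by (auto simp: S_def)
    have "1 \<le> expec S p g"
      using assms(3)[of S] SV by (cases "0 \<in> S") (simp_all add: g_def[abs_def] phi_def)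
    also have "expec S p g = expec S p (\<lambda>A. g (A - Y T))"
    proof (rule expec_cong)
      fix A assume "A \<subseteq> S"
      then have "A - Y T = A" by (auto simp: S_def)
      then show "g A = g (A - Y T)" by simp
    qed
    also have "\<dots> = expec V p (\<lambda>A. g (A - Y T))"
    proof (rule expec_local[symmetric, OF finV SV(1)])
      fix A assume "A \<subseteq> V"
      then have "A \<inter> S - Y T = A - Y T" by (auto simp: S_def)
      then show "g (A - Y T) = g (A \<inter> S - Y T)" by simp
    qed
    finally have g1: "1 \<le> expec V p (\<lambda>A. g (A - Y T))" .
    have "pr V p (\<lambda>A. A \<inter> Y T = T) \<le> pr V p (\<lambda>A. A \<inter> Y T = T) * expec V p (\<lambda>A. g (A - Y T))"
      by (rule order_trans[OF _ mult_left_mono[OF g1 pr_nonneg[OF assms(1,2)]]]) simp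
    also have "\<dots> = expec V p (\<lambda>A. of_bool (A \<inter> Y T = T) * g (A - Y T))"
      unfolding pr_def by (intro expec_indep[symmetric, OF finV, of "Y T"]) (auto simp: Y_def)
    also have "\<dots> \<le> expec V p (\<lambda>A. of_bool (A \<inter> Y T = T) * real (card (N A)))"
    proof (rule expec_mono[OF assms(1,2)])
      fix A assume A: "A \<subseteq> V"
      show "of_bool (A \<inter> Y T = T) * g (A - Y T) \<le> of_bool (A \<inter> Y T = T) * real (card (N A))"
      proof (cases "A \<inter> Y T = T")
        case AT: True
        have T': "tch n A = T"
          using tch_local[of A n T] A AT T by (simp add: V_def Y_def \<T>_def)
        have finN: "finite (N A)" using finV by (simp add: N_def)
        \<comment> \<open>An examined site outside \<open>T\<close> is closed and lies on the rim or
          next to \<open>T\<close>; if the origin can reach it, opening it completes the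
          arm.\<close>
        have shell: "y \<in> N A" if y: "y \<in> Y T - T" "con (insert y A \<inter> V) 0 y" for y
        proof -
          have "y \<notin> A" "y \<in> V" using y AT by (auto simp: Y_def)
          moreover have "arm 0 n (insert y A)"
          proof (cases "y \<in> rim n")
            case True
            then show ?thesis using y by (auto simp: arm_0 V_def)
          next
            case False
            then obtain t where t: "t \<in> T" "adj t y" using y by (auto simp: Y_def nb_def)
            then obtain w where w: "w \<in> rim n" "con (A \<inter> V) t w"
              using T' by (auto simp: tch_def V_def)
            then have "con (insert y A \<inter> V) t w"
              using con_mono[of "A \<inter> V" t w "insert y A \<inter> V"] by auto
            moreover from this have "con (insert y A \<inter> V) 0 t"
              using y(2) t(2) con_step adj_sym con_in by blast
            ultimately show ?thesis
              using w(1) con_trans unfolding arm_0 V_def by blast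
          qed
          ultimately show ?thesis by (simp add: N_def)
        qed
        have "g (A - Y T) \<le> real (card (N A))"
        proof (cases "0 \<in> S")
          case True
          have "nb (cluster (A - Y T) 0) - S \<subseteq> N A"
          proof
            fix y assume "y \<in> nb (cluster (A - Y T) 0) - S"
            then obtain c where c: "con (A - Y T) 0 c" "adj c y" "y \<notin> S"
              by (auto simp: nb_def cluster_def)
            then have cA: "c \<in> A - Y T" using con_in by blast
            then have "c \<in> V" "c \<notin> rim n" using A by (auto simp: Y_def V_def)
            then have "y \<in> V" using c(2) rim_step unfolding V_def by blast
            then have "y \<in> Y T" using c by (auto simp: S_def)
            moreover have "y \<notin> T"
              using adj_sym[OF c(2)] cA \<open>c \<in> V\<close> by (auto simp: Y_def nb_def)
            moreover have "con (insert y A \<inter> V) 0 y"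
            proof (rule con_step[OF _ c(2)])
              show "con (insert y A \<inter> V) 0 c"
                by (rule con_mono[OF c(1)]) (use A in auto)
            qed (use \<open>y \<in> V\<close> in auto)
            ultimately show "y \<in> N A" by (intro shell) auto
          qed
          then show ?thesis using True card_mono[OF finN] by (simp add: g_def)
        next
          case False
          then have "0 \<in> Y T - T" using T by (auto simp: S_def V_def \<T>_def)
          then have "0 \<in> N A" by (intro shell con_refl) (auto simp: V_def)
          then have "1 \<le> card (N A)" using finN card_0_eq by fastforce
          then show ?thesis using False by (simp add: g_def)
        qed
        then show ?thesis using AT by simp
      qed simp
    qed
    finally show "pr V p (\<lambda>A. A \<inter> Y T = T) \<le> expec V p (\<lambda>A. of_bool (A \<inter> Y T = T) * real (card (N A)))" .
  qed
  also have "\<dots> = expec V p (\<lambda>A. \<Sum>T\<in>\<T>. of_bool (A \<inter> Y T = T) * real (card (N A)))"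
    by (simp only: expec_sum)
  also have "\<dots> = expec V p (\<lambda>A. of_bool (\<not> arm 0 n A) * real (card (N A)))"
    using decomp by (intro expec_cong) simp
  also have "\<dots> \<le> expec V p (\<lambda>A. \<Sum>x\<in>V. of_bool (arm 0 n (insert x A)) - of_bool (arm 0 n (A - {x})))"
  proof (rule expec_mono[OF assms(1,2)])
    fix A assume "A \<subseteq> V"
    have "of_bool (\<not> arm 0 n A) * real (card (N A)) =
        (\<Sum>x\<in>V. of_bool (\<not> arm 0 n A) * of_bool (x \<notin> A \<and> arm 0 n (insert x A)))"
      using finV by (simp add: N_def sum_distrib_left[symmetric] Int_def)
    also have "\<dots> \<le> (\<Sum>x\<in>V. of_bool (arm 0 n (insert x A)) - of_bool (arm 0 n (A - {x})))"
    proof (rule sum_mono)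
      fix x
      have "arm 0 n (A - {x}) \<Longrightarrow> arm 0 n (insert x A)"
        by (erule arm_mono) auto
      then show "of_bool (\<not> arm 0 n A) * of_bool (x \<notin> A \<and> arm 0 n (insert x A)) \<le>
          (of_bool (arm 0 n (insert x A)) - of_bool (arm 0 n (A - {x})) :: real)"
        by auto
    qed
    finally show "of_bool (\<not> arm 0 n A) * real (card (N A)) \<le>
        (\<Sum>x\<in>V. of_bool (arm 0 n (insert x A)) - of_bool (arm 0 n (A - {x})))" .
  qed
  finally show ?thesis by (simp only: expec_sum V_def)
qed

text \<open>The derivative of \<open>theta n\<close> is at least \<open>1 - theta n\<close> above
  \<open>q\<close>, since \<open>phi\<close> increases with the parameter. By the mean value theorem
  at \<open>z\<close>, with \<open>theta n z \<le> theta n p\<close>, this can be solved for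
  \<open>theta n p\<close>; the bound is uniform in \<open>n\<close>.\<close>

lemma theta_lower_bound:
  assumes "0 \<le> q" "q < p" "p \<le> 1" "\<And>S. finite S \<Longrightarrow> 0 \<in> S \<Longrightarrow> 1 \<le> phi S q"
  shows "(p - q) / (1 + (p - q)) \<le> theta n p"
proof -
  define D where "D r = (\<Sum>x\<in>block n. expec (block n) r
      (\<lambda>A. of_bool (arm 0 n (insert x A)) - of_bool (arm 0 n (A - {x}))))" for r
  have "((\<lambda>r. theta n r) has_real_derivative D r) (at r)" for r
    unfolding theta_def pr_def D_def by (rule russo) simp
  then obtain z where z: "q < z" "z < p" "theta n p - theta n q = (p - q) * D z"
    using MVT2[of q p "theta n" D] assms(2) by blast
  have "1 \<le> phi S z" if "finite S" "0 \<in> S" for S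
    using assms(4)[OF that] phi_mono[OF that(1), of q z] z assms by linarith
  then have "1 - theta n z \<le> D z"
    unfolding D_def using z assms by (intro pivotal_sum) auto
  moreover have "theta n z \<le> theta n p"
    using z assms by (intro theta_mono) auto
  ultimately have "(p - q) * (1 - theta n p) \<le> theta n p - theta n q"
    using z assms by (auto intro!: mult_left_mono)
  moreover have "0 \<le> theta n q"
    using assms by (intro theta_nonneg) auto
  ultimately have "p - q \<le> theta n p * (1 + (p - q))"
    by (simp add: algebra_simps)
  then show ?thesis using assms by (simp add: field_simps)
qed

section \<open>Few sites join two large clusters\<close>

text \<open>The site \<open>x\<close> is removed from the configuration, so the event ignores its
  own state; opening \<open>x\<close> would merge two clusters that both reach
  \<open>B\<close>.\<close>

definition joins :: "site \<Rightarrow> site set \<Rightarrow> site set \<Rightarrow> site set \<Rightarrow> bool" where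
  "joins x W B A \<longleftrightarrow> (\<exists>u v. adj x u \<and> adj x v \<and> (\<exists>w\<in>B. con (A \<inter> W - {x}) u w) \<and>
     (\<exists>z\<in>B. con (A \<inter> W - {x}) v z) \<and> \<not> con (A \<inter> W - {x}) u v)"

definition mu :: "nat \<Rightarrow> real \<Rightarrow> real" where
  "mu n p = pr (block n) p (joins 0 (block n) (rim n))"

lemma joins_shift_imp:
  assumes "joins x W B A"
  shows "joins (c + x) (shift c W) (shift c B) (shift c A)"
proof -
  have "shift c A \<inter> shift c W - {c + x} = shift c (A \<inter> W - {x})"
    by auto
  then show ?thesis
    using assms adj_shift unfolding joins_def by (metis con_shift imageI)
qed

lemma joins_shift: "joins c (shift c W) (shift c B) (shift c A) \<longleftrightarrow> joins 0 W B A"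
  using joins_shift_imp[of c "shift c W" "shift c B" "shift c A" "- c"] joins_shift_imp[of 0 W B A c]
  by (auto simp: image_image)

lemma joins_local: "joins x W B A \<longleftrightarrow> joins x W B (A \<inter> W)"
  by (simp add: joins_def Int_assoc)

lemma pr_joins:
  assumes "finite V" "shift c (block n) \<subseteq> V"
  shows "pr V p (joins c (shift c (block n)) (shift c (rim n))) = mu n p"
proof -
  have "pr V p (joins c (shift c (block n)) (shift c (rim n))) =
      pr (shift c (block n)) p (joins c (shift c (block n)) (shift c (rim n)))"
    using assms joins_local by (intro pr_local) auto
  then show ?thesis
    by (simp add: pr_shift joins_shift mu_def)
qed

text \<open>The window about \<open>x\<close> contains \<open>block M\<close>: paths to its rim pass
  through \<open>rim M\<close>, and clusters distinct in the larger window stay distinct in the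
  smaller one. By \<open>k < M\<close> the neighbours of \<open>x\<close> lie in
  \<open>block M\<close>.\<close>

lemma joins_shrink:
  assumes "joins x (shift x (block (M + k))) (shift x (rim (M + k))) A" "x \<in> block k" "k < M"
  shows "joins x (block M) (rim M) A"
proof -
  let ?A = "A \<inter> shift x (block (M + k)) - {x}" and ?A' = "A \<inter> block M - {x}"
  have sub: "block M \<subseteq> shift x (block (M + k))"
    using assms(2) unfolding subset_iff mem_shift_block mem_block by (intro allI impI) linarith
  have reach: "\<exists>w\<in>rim M. con ?A' u w"
    if uw: "con ?A u w" "w \<in> shift x (rim (M + k))" "adj x u" for u w
  proof -
    have "u \<in> block M"
      using assms(2,3) adj_bounds[OF uw(3)] unfolding mem_block by linarith
    moreover have "w \<notin> block M \<or> w \<in> rim M"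
      using uw(2) assms(2) unfolding mem_shift_rim mem_rim mem_block by linarith
    ultimately obtain w' where "w' \<in> rim M" "con (?A \<inter> block M) u w'"
      using con_rim[OF uw(1), of 0 M] by auto
    then show ?thesis
      using con_mono[of "?A \<inter> block M" u w' ?A'] by auto
  qed
  obtain u v where "adj x u" "adj x v" "\<exists>w\<in>shift x (rim (M + k)). con ?A u w"
    "\<exists>z\<in>shift x (rim (M + k)). con ?A v z" "\<not> con ?A u v"
    using assms(1) unfolding joins_def by blast
  moreover from this have "\<not> con ?A' u v"
    using con_mono[of ?A' u v ?A] sub by auto
  ultimately show ?thesis
    unfolding joins_def using reach by blast
qed

definition rim_clusters :: "nat \<Rightarrow> site set \<Rightarrow> nat" where
  "rim_clusters n A = card (cluster A ` (A \<inter> rim n))"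

lemma rim_clusters_le: "rim_clusters n A \<le> card (rim n)"
  unfolding rim_clusters_def
  by (rule order_trans[OF card_image_le card_mono]) auto

text \<open>The map \<open>g\<close> sends each old cluster to the new one containing it. It reaches
  every new rim cluster except possibly that of \<open>x\<close>, when \<open>x\<close> is itself on
  the rim; if \<open>x\<close> joins two rim clusters, \<open>g\<close> identifies them and their
  number drops.\<close>

lemma rim_clusters_insert:
  assumes "A \<subseteq> block n"
  shows "real (rim_clusters n (insert x A)) - real (rim_clusters n (A - {x})) \<le>
    of_bool (x \<in> rim n) - of_bool (x \<notin> rim n \<and> joins x (block n) (rim n) A)"
proof -
  define B where "B = A - {x}"
  define B' where "B' = insert x A"
  define \<C> where "\<C> = cluster B ` (B \<inter> rim n)"
  define g where "g C = (\<Union>v\<in>C. cluster B' v)" for C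
  have BB': "B \<subseteq> B'" by (auto simp: B_def B'_def)
  have fin: "finite \<C>" by (simp add: \<C>_def)
  have g: "g (cluster B v) = cluster B' v" if "v \<in> B" for v
  proof -
    have "cluster B' u = cluster B' v" if "u \<in> cluster B v" for u
      using that BB' \<open>v \<in> B\<close> cluster_eq_iff[of v B' u] con_mono by (auto simp: cluster_def)
    moreover have "v \<in> cluster B v" using that by (simp add: cluster_def con_refl)
    ultimately show ?thesis unfolding g_def by blast
  qed
  have "cluster B' ` (B' \<inter> rim n) \<subseteq> g ` \<C> \<union> (if x \<in> rim n then {cluster B' x} else {})"
  proof
    fix C assume "C \<in> cluster B' ` (B' \<inter> rim n)"
    then obtain v where v: "v \<in> B'" "v \<in> rim n" "C = cluster B' v" by blast
    show "C \<in> g ` \<C> \<union> (if x \<in> rim n then {cluster B' x} else {})"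
    proof (cases "v = x")
      case False
      then have "v \<in> B" using v by (auto simp: B_def B'_def)
      then show ?thesis using v g unfolding \<C>_def by blast
    qed (use v in auto)
  qed
  then have "card (cluster B' ` (B' \<inter> rim n)) \<le> card (g ` \<C> \<union> (if x \<in> rim n then {cluster B' x} else {}))"
    using fin by (intro card_mono) auto
  also have "\<dots> \<le> card (g ` \<C>) + card (if x \<in> rim n then {cluster B' x} else {})"
    by (rule card_Un_le)
  also have "card (if x \<in> rim n then {cluster B' x} else {}) = of_bool (x \<in> rim n)"
    by simp
  finally have le: "rim_clusters n B' \<le> card (g ` \<C>) + of_bool (x \<in> rim n)"
    by (simp add: rim_clusters_def)
  have gle: "card (g ` \<C>) \<le> card \<C>"
    using fin by (rule card_image_le)
  have glt: "card (g ` \<C>) < card \<C>" if "joins x (block n) (rim n) A"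
  proof -
    have "A \<inter> block n - {x} = B" using assms by (auto simp: B_def)
    with that obtain u v w z where *: "adj x u" "adj x v" "w \<in> rim n" "con B u w"
      "z \<in> rim n" "con B v z" "\<not> con B u v"
      unfolding joins_def by auto
    have xB': "x \<in> B'" by (simp add: B'_def)
    have eq: "g (cluster B a) = cluster B' x" if "adj x b" "con B b a" for a b
    proof -
      have "con B' x b"
        using that con_in BB' by (intro con_step[OF con_refl[OF xB']]) blast+
      then have "con B' x a"
        using con_trans con_mono[OF that(2) BB'] by blast
      moreover have "a \<in> B" using that con_in by blast
      ultimately show ?thesis
        using g cluster_eq_iff[OF xB', of a] by simp
    qed
    have "\<not> con B w z"
      using * con_trans con_sym by blast
    then have "cluster B w \<noteq> cluster B z"
      using con_in[OF *(4)] by (simp add: cluster_eq_iff)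
    moreover have "cluster B w \<in> \<C>" "cluster B z \<in> \<C>"
      using * con_in unfolding \<C>_def by blast+
    moreover have "g (cluster B w) = g (cluster B z)"
      using eq * by simp
    ultimately have "\<not> inj_on g \<C>"
      unfolding inj_on_def by blast
    then show ?thesis
      using gle eq_card_imp_inj_on[OF fin, of g] by linarith
  qed
  have "card \<C> = rim_clusters n B" by (simp add: \<C>_def rim_clusters_def)
  with le gle glt show ?thesis
    unfolding B_def[symmetric] B'_def[symmetric] by (auto split: if_splits)
qed

lemma card_sym_interval: "card {- int n..int n} = 2 * n + 1"
  by (simp add: nat_add_distrib nat_mult_distrib)

lemma card_block: "card (block n) = (2 * n + 1) ^ 2"
  unfolding block_def card_cartesian_product card_sym_interval power2_eq_square ..

lemma card_rim_le: "card (rim n) \<le> 4 * (2 * n + 1)"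
proof -
  let ?I = "{- int n..int n}"
  have "rim n \<subseteq> {int n} \<times> ?I \<union> {- int n} \<times> ?I \<union> (?I \<times> {int n} \<union> ?I \<times> {- int n})"
  proof
    fix v assume "v \<in> rim n"
    then have "\<bar>fst v\<bar> \<le> int n" "\<bar>snd v\<bar> \<le> int n"
      and "fst v = int n \<or> fst v = - int n \<or> snd v = int n \<or> snd v = - int n"
      unfolding mem_rim mem_block by linarith+
    then show "v \<in> {int n} \<times> ?I \<union> {- int n} \<times> ?I \<union> (?I \<times> {int n} \<union> ?I \<times> {- int n})"
      by (auto simp: mem_Times_iff abs_le_iff)
  qed
  then have "card (rim n) \<le> card ({int n} \<times> ?I \<union> {- int n} \<times> ?I \<union> (?I \<times> {int n} \<union> ?I \<times> {- int n}))"
    by (intro card_mono) auto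
  also have "\<dots> \<le> (card ({int n} \<times> ?I) + card ({- int n} \<times> ?I)) +
      (card (?I \<times> {int n}) + card (?I \<times> {- int n}))"
    by (intro order_trans[OF card_Un_le] add_mono card_Un_le)
  also have "\<dots> = 4 * (2 * n + 1)"
    unfolding card_cartesian_product card_sym_interval by simp
  finally show ?thesis .
qed

text \<open>Opening a site that joins two rim clusters lowers their number, so Russo's formula bounds the
  average number of such sites by the size of the rim; there are many more sites inside.\<close>

lemma mu_small:
  assumes "0 \<le> p1" "p1 < p2" "p2 \<le> 1" "0 < M"
  shows "\<exists>\<xi>. p1 < \<xi> \<and> \<xi> < p2 \<and> mu (3 * M) \<xi> \<le> 5 * (1 + 1 / (p2 - p1)) / real M"
proof -
  let ?V = "block (2 * M)" and ?J = "\<lambda>x. joins x (block (2 * M)) (rim (2 * M))"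
  let ?R = "real (card (rim (2 * M)))"
  define f where "f A = real (rim_clusters (2 * M) A)" for A
  define D where "D p = (\<Sum>x\<in>?V. expec ?V p (\<lambda>A. f (insert x A) - f (A - {x})))" for p
  have "((\<lambda>p. expec ?V p f) has_real_derivative D p) (at p)" for p
    unfolding D_def by (rule russo) simp
  then obtain \<xi> where \<xi>: "p1 < \<xi>" "\<xi> < p2" "expec ?V p2 f - expec ?V p1 f = (p2 - p1) * D \<xi>"
    using MVT2[of p1 p2 "\<lambda>p. expec ?V p f" D] assms(2) by blast
  have \<xi>01: "0 \<le> \<xi>" "\<xi> \<le> 1" using \<xi> assms by auto
  have "f A \<le> ?R" for A
    using rim_clusters_le[of "2 * M" A] by (simp add: f_def)
  then have "expec ?V p1 f \<le> expec ?V p1 (\<lambda>_. ?R)"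
    using assms by (intro expec_mono) auto
  moreover have "expec ?V p2 (\<lambda>_. 0) \<le> expec ?V p2 f"
    using assms by (intro expec_mono) (auto simp: f_def)
  ultimately have "- ?R \<le> (p2 - p1) * D \<xi>"
    using \<xi>(3) by simp
  then have D_ge: "- ?R / (p2 - p1) \<le> D \<xi>"
    using assms by (simp add: field_simps)
  \<comment> \<open>A window of radius \<open>3 * M\<close> about any \<open>x\<close> in
    \<open>block M\<close> contains \<open>block (2 * M)\<close>, so the single number
    \<open>mu (3 * M) \<xi>\<close> bounds the joining probabilities of all these sites from
    below.\<close>
  have mu_le: "mu (3 * M) \<xi> \<le> pr ?V \<xi> (?J x)" if x: "x \<in> block M" for x
  proof -
    let ?W = "block (4 * M)"
    have "shift x (block (3 * M)) \<subseteq> ?W"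
      using x unfolding subset_iff mem_shift_block mem_block by (intro allI impI) linarith
    then have "mu (3 * M) \<xi> = pr ?W \<xi> (joins x (shift x (block (2 * M + M))) (shift x (rim (2 * M + M))))"
      using pr_joins[of ?W x "3 * M" \<xi>] by (simp add: add_ac)
    also have "\<dots> \<le> pr ?W \<xi> (?J x)"
      using x assms \<xi>01 by (intro pr_mono joins_shrink) auto
    also have "\<dots> = pr ?V \<xi> (?J x)"
      using joins_local block_mono[of "2 * M" "4 * M"] by (intro pr_local) simp_all
    finally show ?thesis .
  qed
  have "D \<xi> \<le> (\<Sum>x\<in>?V. of_bool (x \<in> rim (2 * M)) - pr ?V \<xi> (\<lambda>A. x \<notin> rim (2 * M) \<and> ?J x A))"
    unfolding D_def
  proof (rule sum_mono)
    fix x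
    have "expec ?V \<xi> (\<lambda>A. f (insert x A) - f (A - {x})) \<le>
        expec ?V \<xi> (\<lambda>A. of_bool (x \<in> rim (2 * M)) - of_bool (x \<notin> rim (2 * M) \<and> ?J x A))"
      unfolding f_def using \<xi>01 by (intro expec_mono rim_clusters_insert) auto
    then show "expec ?V \<xi> (\<lambda>A. f (insert x A) - f (A - {x})) \<le>
        of_bool (x \<in> rim (2 * M)) - pr ?V \<xi> (\<lambda>A. x \<notin> rim (2 * M) \<and> ?J x A)"
      by (simp only: expec_diff expec_const finite_block pr_def)
  qed
  also have "\<dots> = ?R - (\<Sum>x\<in>?V. pr ?V \<xi> (\<lambda>A. x \<notin> rim (2 * M) \<and> ?J x A))"
    using rim_subset[of "2 * M"] by (simp add: sum_subtractf Int_absorb1)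
  also have "\<dots> \<le> ?R - (\<Sum>x\<in>block M. pr ?V \<xi> (\<lambda>A. x \<notin> rim (2 * M) \<and> ?J x A))"
    using \<xi>01 block_mono[of M "2 * M"] by (intro diff_left_mono sum_mono2) (auto intro: pr_nonneg)
  also have "\<dots> = ?R - (\<Sum>x\<in>block M. pr ?V \<xi> (?J x))"
  proof -
    have "x \<notin> rim (2 * M)" if "x \<in> block M" for x
      using that assms(4) by (auto simp: mem_block mem_rim)
    then show ?thesis by simp
  qed
  also have "\<dots> \<le> ?R - (\<Sum>x\<in>block M. mu (3 * M) \<xi>)"
    using mu_le by (intro diff_left_mono sum_mono)
  finally have "real (card (block M)) * mu (3 * M) \<xi> \<le> ?R * (1 + 1 / (p2 - p1))"
    using D_ge by (simp add: algebra_simps)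
  \<comment> \<open>The rim has at most \<open>16 * M + 4\<close> sites, hence at most
    \<open>20 * M\<close>; against at least \<open>4 * M * M\<close> sites in \<open>block M\<close>
    this leaves the constant 5.\<close>
  also have "\<dots> \<le> (20 * real M) * (1 + 1 / (p2 - p1))"
    using card_rim_le[of "2 * M"] assms by (intro mult_right_mono) auto
  finally have "real (card (block M)) * mu (3 * M) \<xi> \<le> (20 * real M) * (1 + 1 / (p2 - p1))" .
  moreover have "4 * (real M * real M) * mu (3 * M) \<xi> \<le> real (card (block M)) * mu (3 * M) \<xi>"
    using \<xi>01 by (intro mult_right_mono) (auto simp: card_block power2_eq_square mu_def pr_nonneg algebra_simps)
  ultimately have "(4 * real M) * (real M * mu (3 * M) \<xi>) \<le> (4 * real M) * (5 * (1 + 1 / (p2 - p1)))"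
    by (simp add: algebra_simps)
  then have "real M * mu (3 * M) \<xi> \<le> 5 * (1 + 1 / (p2 - p1))"
    using assms(4) by (subst (asm) mult_le_cancel_left_pos) auto
  then have "mu (3 * M) \<xi> \<le> 5 * (1 + 1 / (p2 - p1)) / real M"
    using assms(4) by (simp add: pos_le_divide_eq mult.commute)
  then show ?thesis using \<xi> by blast
qed

lemma con_block:
  assumes "u \<in> block k" "v \<in> block k"
  shows "con (block k) u v"
proof -
  have "con (block k) (- int k, - int k) w" if "w \<in> block k" for w
  proof -
    have row: "con (block k) (- int k, - int k) (- int k + int n, - int k)" if "n \<le> 2 * k" for n
      using that
    proof (induction n)
      case (Suc n)
      then show ?case
        by - (rule con_step[of _ _ "(- int k + int n, - int k)"], simp_all add: mem_block)
    qed (simp add: con_refl mem_block)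
    have col: "con (block k) (i, - int k) (i, - int k + int n)" if "n \<le> 2 * k" "\<bar>i\<bar> \<le> int k" for n i
      using that
    proof (induction n)
      case (Suc n)
      then show ?case
        by - (rule con_step[of _ _ "(i, - int k + int n)"], simp_all add: mem_block)
    qed (simp add: con_refl mem_block)
    obtain i j where w: "w = (i, j)" "\<bar>i\<bar> \<le> int k" "\<bar>j\<bar> \<le> int k"
      using \<open>w \<in> block k\<close> by (cases w) (auto simp: mem_block)
    define a b where "a = nat (i + int k)" and "b = nat (j + int k)"
    then have ab: "i = - int k + int a" "j = - int k + int b" "a \<le> 2 * k" "b \<le> 2 * k"
      using w by linarith+
    then show ?thesis
      using con_trans[OF row[OF ab(3)] col[OF ab(4), of "- int k + int a"]] w by simp
  qed
  from this[OF assms(1)] this[OF assms(2)] show ?thesis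
    by (rule con_trans[OF con_sym])
qed

definition two_arms :: "nat \<Rightarrow> nat \<Rightarrow> site set \<Rightarrow> bool" where
  "two_arms k n A \<longleftrightarrow> (\<exists>u\<in>block k. \<exists>v\<in>block k. (\<exists>w\<in>rim n. con A u w) \<and> (\<exists>z\<in>rim n. con A v z) \<and> \<not> con A u v)"

text \<open>Opening the sites of a path between the two clusters one by one, some site joins them.\<close>

lemma two_arms_imp_joins:
  assumes "A \<subseteq> block (n + k)" "0 < n" "two_arms k (n + k) A"
  shows "\<exists>x\<in>block k. \<exists>D\<subseteq>block k. joins x (shift x (block n)) (shift x (rim n)) (A - block k \<union> D)"
proof (rule ccontr)
  assume no_join: "\<not> ?thesis"
  obtain u v w z where uv: "u \<in> block k" "v \<in> block k" "w \<in> rim (n + k)" "con A u w"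
    "z \<in> rim (n + k)" "con A v z" "\<not> con A u v"
    using assms(3) unfolding two_arms_def by blast
  \<comment> \<open>Invariant along a path in \<open>block k\<close> starting at \<open>u\<close>:
    the sites \<open>D\<close> opened so far connect \<open>u\<close> to the current site but not
    yet to \<open>v\<close>.\<close>
  have "\<exists>D\<subseteq>block k. con (A \<union> D) u c \<and> \<not> con (A \<union> D) u v" if "con (block k) u c" for c
    using that
  proof (induction rule: con_induct)
    case refl
    then show ?case
      using uv con_in[OF uv(4)] by (intro exI[of _ "{}"]) (auto intro: con_refl)
  next
    case (step c c')
    then obtain D where D: "D \<subseteq> block k" "con (A \<union> D) u c" "\<not> con (A \<union> D) u v" by blast
    let ?B = "A \<union> D"
    have c': "con (insert c' ?B) u c'"
      using con_step[of "insert c' ?B" u c c'] con_mono[OF D(2), of "insert c' ?B"] step.hyps(2) by blast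
    show ?case
    proof (cases "con (insert c' ?B) u v")
      case False
      then show ?thesis
        using c' step D by (intro exI[of _ "insert c' D"]) auto
    next
      case True
      have c'B: "c' \<notin> ?B"
        using True D(3) by (auto simp: insert_absorb)
      have "con (insert c' ?B) c' v"
        using c' True con_sym con_trans by blast
      moreover have "v \<noteq> c'"
        using c'B uv con_in by blast
      \<comment> \<open>After its last visit to \<open>c'\<close>, the path to \<open>v\<close>
        continues at a neighbour \<open>y\<close> that was connected to \<open>v\<close> before
        \<open>c'\<close> was opened. As \<open>c\<close> is connected to \<open>u\<close>, the
        sites \<open>c\<close> and \<open>y\<close> lie in different clusters.\<close>
      ultimately obtain y where y: "adj c' y" "con (insert c' ?B - {c'}) y v"
        using con_last_exit[of "insert c' ?B" c' v "{c'}"] by auto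
      then have yv: "con ?B y v" using c'B by simp
      have cw: "con ?B c w"
        using con_mono[OF uv(4), of ?B] D(2) con_sym con_trans by blast
      have yz: "con ?B y z"
        using con_mono[OF uv(6), of ?B] yv con_trans by blast
      have ncy: "\<not> con ?B c y"
        using D yv con_trans by blast
      have reach: "\<exists>w'\<in>shift c' (rim n). con (?B \<inter> shift c' (block n)) a w'"
        if "con ?B a b" "adj c' a" "b \<in> rim (n + k)" for a b
      proof (rule con_rim[OF that(1)])
        show "a \<in> shift c' (block n)"
          using adj_bounds[OF that(2)] assms(2) unfolding mem_shift_block by linarith
        show "b \<notin> shift c' (block n) \<or> b \<in> shift c' (rim n)"
          using that(3) step.hyps(3) unfolding mem_shift_rim mem_shift_block mem_rim mem_block by linarith
      qed
      \<comment> \<open>The conclusion first empties \<open>block k\<close>, so the witness has to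
        restore the part of \<open>A\<close> inside it.\<close>
      have B: "A - block k \<union> (A \<inter> block k \<union> D) = ?B" by auto
      have win: "?B \<inter> shift c' (block n) - {c'} = ?B \<inter> shift c' (block n)" using c'B by auto
      have "\<not> con (?B \<inter> shift c' (block n)) c y"
        using ncy con_mono by blast
      then have "joins c' (shift c' (block n)) (shift c' (rim n)) (A - block k \<union> (A \<inter> block k \<union> D))"
        unfolding joins_def B win
        using reach[OF cw adj_sym[OF step.hyps(2)] uv(3)] reach[OF yz y(1) uv(5)]
          adj_sym[OF step.hyps(2)] y(1) by blast
      moreover have "A \<inter> block k \<union> D \<subseteq> block k" using D by auto
      ultimately have False using no_join step.hyps(3) by blast
      then show ?thesis ..
    qed
  qed
  from this[OF con_block[OF uv(1,2)]] obtain D where "con (A \<union> D) u v" "\<not> con (A \<union> D) u v" by blast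
  then show False by blast
qed

text \<open>The joining site appears only after a change on \<open>block k\<close>; finite energy
  charges this change with a factor that is constant once \<open>k\<close> is fixed.\<close>

lemma two_arms_le:
  assumes "0 \<le> m" "m \<le> p" "m \<le> 1 - p" "0 < n"
  shows "m ^ card (block k) * pr (block (n + k)) p (two_arms k (n + k)) \<le> real (card (block k)) * mu n p"
proof -
  let ?V = "block (n + k)"
  let ?J = "\<lambda>x. joins x (shift x (block n)) (shift x (rim n))"
  have p: "0 \<le> p" "p \<le> 1" using assms by auto
  have "pr ?V p (two_arms k (n + k)) \<le> pr ?V p (\<lambda>A. \<exists>x\<in>block k. \<exists>D\<subseteq>block k. ?J x (A - block k \<union> D))"
    using p assms two_arms_imp_joins by (intro pr_mono) auto
  also have "\<dots> \<le> (\<Sum>x\<in>block k. pr ?V p (\<lambda>A. \<exists>D\<subseteq>block k. ?J x (A - block k \<union> D)))"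
    using p by (intro pr_Bex_le) auto
  finally have "m ^ card (block k) * pr ?V p (two_arms k (n + k)) \<le>
      (\<Sum>x\<in>block k. m ^ card (block k) * pr ?V p (\<lambda>A. \<exists>D\<subseteq>block k. ?J x (A - block k \<union> D)))"
    using assms by (simp add: mult_left_mono sum_distrib_left[symmetric])
  also have "\<dots> \<le> (\<Sum>x\<in>block k. pr ?V p (?J x))"
    using assms block_mono[of k "n + k"] by (intro sum_mono finite_energy) auto
  also have "\<dots> = (\<Sum>x\<in>block k. mu n p)"
  proof (intro sum.cong refl pr_joins)
    fix x assume "x \<in> block k"
    then show "shift x (block n) \<subseteq> ?V"
      unfolding subset_iff mem_shift_block mem_block by (intro allI impI) linarith
  qed simp
  finally show ?thesis by simp
qed

section \<open>Exponential decay below one half\<close>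

definition reach :: "nat \<Rightarrow> site set \<Rightarrow> site set \<Rightarrow> bool" where
  "reach k T A \<longleftrightarrow> (\<exists>u\<in>block k. \<exists>w\<in>T. con A u w)"

lemma reach_mono: "reach k T A \<Longrightarrow> A \<subseteq> B \<Longrightarrow> reach k T B"
  unfolding reach_def using con_mono by blast

lemma pr_no_arms:
  assumes "finite W" "\<And>i. i < r \<Longrightarrow> shift (x i) (block m) \<subseteq> W"
    and "\<And>i j. i < j \<Longrightarrow> j < r \<Longrightarrow> shift (x i) (block m) \<inter> shift (x j) (block m) = {}"
  shows "pr W p (\<lambda>A. \<forall>i<r. \<not> arm (x i) m A) = (1 - theta m p) ^ r"
  using assms(2,3)
proof (induction r)
  case 0
  then show ?case using assms(1) by (simp add: pr_def)
next
  case (Suc r)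
  let ?f = "\<lambda>A. of_bool (\<not> arm (x r) m A) :: real" and ?g = "\<lambda>A. of_bool (\<forall>i<r. \<not> arm (x i) m A) :: real"
  have "pr W p (\<lambda>A. \<forall>i<Suc r. \<not> arm (x i) m A) = expec W p (\<lambda>A. ?f A * ?g A)"
    unfolding pr_def by (intro expec_cong) (auto simp: less_Suc_eq)
  also have "\<dots> = expec W p ?f * expec W p ?g"
  proof (rule expec_indep[OF assms(1), of "shift (x r) (block m)"])
    show "?f A = ?f (A \<inter> shift (x r) (block m))" for A
      using arm_local by simp
    show "?g A = ?g (A - shift (x r) (block m))" for A
    proof -
      have "arm (x i) m A \<longleftrightarrow> arm (x i) m (A - shift (x r) (block m))" if "i < r" for i
      proof -
        have "(A - shift (x r) (block m)) \<inter> shift (x i) (block m) = A \<inter> shift (x i) (block m)"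
          using Suc.prems(2)[of i r] that by blast
        then show ?thesis
          using arm_local[of "x i" m A] arm_local[of "x i" m "A - shift (x r) (block m)"] by simp
      qed
      then show ?thesis by simp
    qed
  qed (use Suc in auto)
  also have "expec W p ?f = 1 - theta m p"
    using pr_not[OF assms(1), of p "arm (x r) m"] pr_arm[OF assms(1), of "x r" m p] Suc.prems(1)[of r]
    by (simp add: pr_def)
  also have "expec W p ?g = (1 - theta m p) ^ r"
    using Suc by (simp add: pr_def)
  finally show ?case by simp
qed

text \<open>Far apart sites have nearly independent chances of being connected far away, because the
  probability of reaching distance \<open>n\<close> without reaching infinity vanishes.\<close>

lemma reach_likely:
  assumes "0 \<le> p" "p \<le> 1" "0 < c" "\<And>n. c \<le> theta n p" "0 < \<epsilon>"
  shows "\<exists>k. \<forall>N\<ge>k. 1 - \<epsilon> \<le> pr (block N) p (reach k (rim N))"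
proof -
  have "1 - c < 1" "0 < \<epsilon> / 2" using assms by auto
  \<comment> \<open>Failure of \<open>r\<close> independent attempts takes half of
    \<open>\<epsilon>\<close>; the other half is shared by \<open>r\<close> errors of size
    \<open>\<eta>\<close>.\<close>
  then obtain r where r: "(1 - c) ^ r < \<epsilon> / 2"
    using real_arch_pow_inv[of "\<epsilon> / 2" "1 - c"] by blast
  define \<eta> where "\<eta> = \<epsilon> / (2 * (real r + 1))"
  have \<eta>: "0 < \<eta>" "real r * \<eta> \<le> \<epsilon> / 2"
    using assms by (auto simp: \<eta>_def field_simps)
  have "decseq (\<lambda>n. theta n p)"
    using assms by (auto simp: decseq_def intro: theta_antimono)
  then obtain l where l: "(\<lambda>n. theta n p) \<longlonglongrightarrow> l" "\<And>n. l \<le> theta n p"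
    using decseq_convergent[of "\<lambda>n. theta n p" c] assms by auto
  \<comment> \<open>From radius \<open>m\<close> on, \<open>theta n p\<close> is within
    \<open>\<eta>\<close> of its limit, so an arm of length \<open>m\<close> fails to extend with
    probability at most \<open>\<eta>\<close>.\<close>
  then obtain m where m: "theta m p < l + \<eta>"
    using order_tendstoD(2)[OF l(1), of "l + \<eta>"] \<eta> by (auto simp: eventually_sequentially)
  \<comment> \<open>Boxes of radius \<open>m\<close> with centres \<open>2 * m + 1\<close> apart are
    disjoint, which makes their arms independent; \<open>block k\<close> contains the
    \<open>r\<close> centres.\<close>
  define k where "k = r * (2 * m + 1)"
  define x where "x i = (int i * (2 * int m + 1), 0 :: int)" for i :: nat
  have xk: "int i * (2 * int m + 1) + (2 * int m + 1) \<le> int k" if "i < r" for i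
  proof -
    have "(i + 1) * (2 * m + 1) \<le> k" unfolding k_def using that by (intro mult_right_mono) auto
    then have "int ((i + 1) * (2 * m + 1)) \<le> int k" by (simp only: of_nat_le_iff)
    then show ?thesis by (simp add: algebra_simps)
  qed
  have "1 - \<epsilon> \<le> pr (block N) p (reach k (rim N))" if "k \<le> N" for N
  proof -
    let ?W = "block (N + 2 * k)"
    have W: "shift (x i) (block m) \<subseteq> ?W" "shift (x i) (block (N + k)) \<subseteq> ?W" if "i < r" for i
    proof -
      have "0 \<le> fst (x i)" "fst (x i) + m \<le> k" "snd (x i) = 0"
        using xk[OF that] by (auto simp: x_def)
      then show "shift (x i) (block m) \<subseteq> ?W" "shift (x i) (block (N + k)) \<subseteq> ?W"
        unfolding subset_iff mem_shift_block mem_block by (intro allI impI; linarith)+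
    qed
    have disj: "shift (x i) (block m) \<inter> shift (x j) (block m) = {}" if "i < j" "j < r" for i j
    proof -
      have "int (i + 1) * (2 * int m + 1) \<le> int j * (2 * int m + 1)"
        using that by (intro mult_right_mono) auto
      then have "fst (x i) + (2 * int m + 1) \<le> fst (x j)"
        by (simp add: x_def algebra_simps)
      then show ?thesis
        unfolding disjoint_iff mem_shift_block by (intro allI impI) linarith
    qed
    have "1 - pr (block N) p (reach k (rim N)) = pr (block N) p (\<lambda>A. \<not> reach k (rim N) A)"
      by (simp add: pr_not)
    also have "\<dots> = pr (block N) p (\<lambda>A. \<not> reach k (rim N) (A \<inter> block N))"
      by (intro pr_cong) (simp add: Int_absorb2)
    also have "\<dots> = pr ?W p (\<lambda>A. \<not> reach k (rim N) (A \<inter> block N))"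
      using block_mono[of N "N + 2 * k"] by (intro pr_local[symmetric]) (auto simp: Int_assoc)
    also have "\<dots> \<le> pr ?W p (\<lambda>A. (\<forall>i<r. \<not> arm (x i) m A) \<or>
        (\<exists>i\<in>{..<r}. arm (x i) m A \<and> \<not> arm (x i) (N + k) A))"
    proof (rule pr_mono[OF assms(1,2)])
      fix A assume A: "\<not> reach k (rim N) (A \<inter> block N)"
      have "\<not> arm (x i) (N + k) A" if "i < r" for i
      proof
        assume "arm (x i) (N + k) A"
        then obtain w where w: "w \<in> shift (x i) (rim (N + k))" "con (A \<inter> shift (x i) (block (N + k))) (x i) w"
          unfolding arm_def by blast
        have xi: "0 \<le> fst (x i)" "fst (x i) \<le> k" "snd (x i) = 0"
          using xk[OF that] by (auto simp: x_def)
        then have xb: "x i \<in> block k" "x i \<in> block N"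
          using \<open>k \<le> N\<close> unfolding mem_block by auto
        have "w \<notin> block N \<or> w \<in> rim N"
          using w(1) xi unfolding mem_shift_rim mem_rim mem_block by linarith
        then obtain w' where "w' \<in> rim N" "con (A \<inter> shift (x i) (block (N + k)) \<inter> block N) (x i) w'"
          using con_rim[OF w(2), of 0 N] xb by auto
        then have "reach k (rim N) (A \<inter> block N)"
          using xb con_mono[of _ _ w' "A \<inter> block N"] unfolding reach_def by blast
        then show False using A by simp
      qed
      then show "(\<forall>i<r. \<not> arm (x i) m A) \<or> (\<exists>i\<in>{..<r}. arm (x i) m A \<and> \<not> arm (x i) (N + k) A)"
        by auto
    qed
    also have "\<dots> \<le> pr ?W p (\<lambda>A. \<forall>i<r. \<not> arm (x i) m A) +
        (\<Sum>i\<in>{..<r}. pr ?W p (\<lambda>A. arm (x i) m A \<and> \<not> arm (x i) (N + k) A))"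
      using assms by (intro order_trans[OF pr_disj_le] add_mono pr_Bex_le) auto
    also have "(\<Sum>i\<in>{..<r}. pr ?W p (\<lambda>A. arm (x i) m A \<and> \<not> arm (x i) (N + k) A)) \<le> (\<Sum>i\<in>{..<r}. \<eta>)"
    proof (rule sum_mono)
      fix i assume "i \<in> {..<r}"
      then have i: "i < r" by simp
      have "m \<le> N + k"
      proof -
        have "int m \<le> int k" using xk[OF i] by (smt (verit) of_nat_0_le_iff mult_nonneg_nonneg)
        then show ?thesis by simp
      qed
      then have "pr ?W p (\<lambda>A. arm (x i) m A \<and> \<not> arm (x i) (N + k) A) =
          expec ?W p (\<lambda>A. of_bool (arm (x i) m A) - of_bool (arm (x i) (N + k) A))"
        unfolding pr_def by (intro expec_cong) (auto intro: arm_antimono)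
      also have "\<dots> = theta m p - theta (N + k) p"
        using pr_arm[OF finite_block W(1)[OF i], of p] pr_arm[OF finite_block W(2)[OF i], of p]
        by (simp add: expec_diff pr_def)
      also have "\<dots> \<le> \<eta>"
        using m l(2)[of "N + k"] by simp
      finally show "pr ?W p (\<lambda>A. arm (x i) m A \<and> \<not> arm (x i) (N + k) A) \<le> \<eta>" .
    qed
    also have "pr ?W p (\<lambda>A. \<forall>i<r. \<not> arm (x i) m A) = (1 - theta m p) ^ r"
      using W disj by (intro pr_no_arms) auto
    also have "(1 - theta m p) ^ r \<le> (1 - c) ^ r"
      using assms theta_le_1[of p m] by (intro power_mono) auto
    finally show ?thesis
      using r \<eta> by simp
  qed
  then show ?thesis by blast
qed

section \<open>Crossing probabilities of a rhombus\<close>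

definition lr :: "nat \<Rightarrow> site set \<Rightarrow> bool" where
  "lr n A \<longleftrightarrow> (\<exists>u w. con A u w \<and> fst u = - int n \<and> fst w = int n)"

lemma lr_mono: "lr n A \<Longrightarrow> A \<subseteq> B \<Longrightarrow> lr n B"
  unfolding lr_def using con_mono by blast

lemma adj_swap: "adj u v \<Longrightarrow> adj (prod.swap u) (prod.swap v)"
  by (cases u; cases v) auto

lemma adj_uminus: "adj u v \<Longrightarrow> adj (- u) (- v)"
  by (cases u; cases v) auto

lemma swap_block: "prod.swap ` block n = block n"
  by (auto simp: block_def image_iff)

lemma involution_image:
  assumes "\<And>v. \<pi> (\<pi> v) = v" "\<And>v. P v \<longleftrightarrow> Q (\<pi> v)"
  shows "{v. P v} = \<pi> ` {v. Q v}"
proof (intro subset_antisym subsetI)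
  fix v assume "v \<in> {v. P v}"
  then show "v \<in> \<pi> ` {v. Q v}"
    using assms by (intro image_eqI[of v \<pi> "\<pi> v"]) auto
qed (use assms in auto)

lemma uminus_block: "uminus ` block n = block n"
proof -
  have "v \<in> block n \<longleftrightarrow> - v \<in> block n" for v :: site
    by (simp add: mem_block)
  then show ?thesis
    using involution_image[of uminus "\<lambda>v. v \<in> block n" "\<lambda>v. v \<in> block n"] by simp
qed

text \<open>Raising \<open>p\<close> to \<open>1 - p\<close>, reflecting in the diagonal and
  exchanging colours turns the event into a closed bottom-top crossing at \<open>p\<close>, which
  excludes an open left-right crossing.\<close>

lemma lr_half:
  assumes "0 \<le> p" "p \<le> 1 / 2"
  shows "pr (block n) p (lr n) \<le> 1 / 2"
proof -
  let ?V = "block n" and ?tb = "\<lambda>A. lr n (prod.swap ` A)"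
  have "pr ?V p (lr n) \<le> pr ?V (1 - p) (lr n)"
    using assms lr_mono by (intro pr_mono_p) auto
  also have "\<dots> = pr ?V (1 - p) ?tb"
    using expec_image[of prod.swap ?V "1 - p" "\<lambda>A. of_bool (lr n A)"] by (simp add: pr_def swap_block)
  also have "\<dots> = expec ?V (1 - p) (\<lambda>A. of_bool (?tb (?V - (?V - A))))"
    unfolding pr_def by (intro expec_cong) (simp add: double_diff)
  also have "\<dots> = pr ?V p (\<lambda>A. ?tb (?V - A))"
    unfolding pr_def by (subst (2) expec_compl) simp_all
  also have "\<dots> \<le> pr ?V p (\<lambda>A. \<not> lr n A)"
  proof (intro pr_mono)
    fix A assume A: "A \<subseteq> ?V" "?tb (?V - A)"
    then obtain s t where st: "con (prod.swap ` (?V - A)) s t" "fst s = - int n" "fst t = int n"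
      unfolding lr_def by blast
    then have "con (prod.swap ` prod.swap ` (?V - A)) (prod.swap s) (prod.swap t)"
      by (intro con_image adj_swap)
    then have st': "con (?V - A) (prod.swap s) (prod.swap t)"
      by (simp add: image_image)
    show "\<not> lr n A"
    proof
      assume "lr n A"
      then obtain u w where uw: "con A u w" "fst u = - int n" "fst w = int n"
        unfolding lr_def by blast
      have "- int n \<le> snd v \<and> snd v \<le> int n" if "v \<in> A" for v
        using that A(1) mem_block[of v n] by (auto simp: abs_le_iff)
      moreover have "- int n \<le> fst v \<and> fst v \<le> int n" if "v \<in> ?V - A" for v
        using that mem_block[of v n] by (auto simp: abs_le_iff)
      ultimately have "A \<inter> (?V - A) \<noteq> {}"
        using uw st by (intro crossings_meet[OF uw(1) _ _ _ st',
              where ?y1.0 = "- int n" and ?y2.0 = "int n" and ?x1.0 = "- int n" and ?x2.0 = "int n"]) auto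
      then show False by blast
    qed
  qed (use assms in auto)
  finally show ?thesis by (simp add: pr_not)
qed

lemma pr_reach_sym:
  assumes "\<And>u v. adj u v \<Longrightarrow> adj (\<pi> u) (\<pi> v)" "\<And>v. \<pi> (\<pi> v) = v" "\<And>n. \<pi> ` block n = block n"
  shows "pr (block N) p (reach k (\<pi> ` T)) = pr (block N) p (reach k T)"
proof -
  have inj: "inj_on \<pi> (block N)"
    using assms(2) by (metis inj_onI)
  have "reach k (\<pi> ` T) (\<pi> ` A)" if "reach k T A" for T A
    using that con_image[of \<pi>, OF assms(1)] assms(3)[of k] unfolding reach_def by blast
  moreover have "\<pi> ` \<pi> ` A = A" for A
    using assms(2) by (simp add: image_image)
  ultimately have "reach k (\<pi> ` T) (\<pi> ` A) \<longleftrightarrow> reach k T A" for A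
    by metis
  moreover have "pr (\<pi> ` block N) p (reach k (\<pi> ` T)) = pr (block N) p (\<lambda>A. reach k (\<pi> ` T) (\<pi> ` A))"
    unfolding pr_def using inj by (intro expec_image) auto
  ultimately show ?thesis by (simp add: assms(3))
qed

text \<open>Square root trick: half turn and reflection make the four sides equally likely to be
  missed, and Harris gives \<open>q ^ 4\<close> as a lower bound for missing the whole rim, so
  \<open>q \<le> 1 / 8\<close>. If left and right sides are both reached and the arms are connected,
  they form a crossing; failure costs \<open>1 / 8 + 1 / 8\<close> plus the two-arm
  probability.\<close>

lemma lr_likely:
  assumes "0 \<le> p" "p \<le> 1" "1 - (1 / 8) ^ 4 \<le> pr (block N) p (reach k (rim N))"
  shows "3 / 4 - pr (block N) p (two_arms k N) \<le> pr (block N) p (lr N)"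
proof -
  let ?P = "pr (block N) p"
  let ?L = "{v \<in> block N. fst v = - int N}" and ?R = "{v \<in> block N. fst v = int N}"
  let ?B = "{v \<in> block N. snd v = - int N}" and ?T = "{v \<in> block N. snd v = int N}"
  have mono: "reach k X A \<or> reach k Y A \<Longrightarrow> A \<subseteq> A' \<Longrightarrow> reach k X A' \<or> reach k Y A'" for X Y A A'
    using reach_mono by blast
  define q where "q = ?P (\<lambda>A. \<not> reach k ?L A)"
  have sets: "?R = uminus ` ?L" "?B = prod.swap ` ?L" "?T = uminus ` ?B"
    by (rule involution_image; auto simp: mem_block)+
  have eqs: "?P (reach k ?R) = ?P (reach k ?L)" "?P (reach k ?B) = ?P (reach k ?L)"
    "?P (reach k ?T) = ?P (reach k ?B)"
    unfolding sets by (intro pr_reach_sym adj_uminus adj_swap uminus_block swap_block; simp)+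
  have q: "?P (\<lambda>A. \<not> reach k X A) = q" if "X \<in> {?L, ?R, ?B, ?T}" for X
    using that eqs unfolding q_def by (auto simp: pr_not)
  have q0: "0 \<le> q" using assms by (simp add: q_def pr_nonneg)
  have "q * q \<le> ?P (\<lambda>A. \<not> reach k ?L A \<and> \<not> reach k ?R A)"
    using pr_harris_not[of "block N" p "reach k ?L" "reach k ?R"] assms reach_mono q[of ?L] q[of ?R] by auto
  moreover have "q * q \<le> ?P (\<lambda>A. \<not> reach k ?B A \<and> \<not> reach k ?T A)"
    using pr_harris_not[of "block N" p "reach k ?B" "reach k ?T"] assms reach_mono q[of ?B] q[of ?T] by auto
  ultimately have "(q * q) * (q * q) \<le>
      ?P (\<lambda>A. \<not> (reach k ?L A \<or> reach k ?R A)) * ?P (\<lambda>A. \<not> (reach k ?B A \<or> reach k ?T A))"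
    using q0 by (intro mult_mono) (simp_all add: pr_nonneg assms)
  also have "\<dots> \<le> ?P (\<lambda>A. \<not> (reach k ?L A \<or> reach k ?R A) \<and> \<not> (reach k ?B A \<or> reach k ?T A))"
    using assms mono by (intro pr_harris_not) auto
  also have "\<dots> \<le> ?P (\<lambda>A. \<not> reach k (rim N) A)"
  proof (intro pr_mono assms impI)
    fix A assume *: "\<not> (reach k ?L A \<or> reach k ?R A) \<and> \<not> (reach k ?B A \<or> reach k ?T A)"
    have "rim N \<subseteq> ?L \<union> ?R \<union> (?B \<union> ?T)"
      by (auto simp: rim_def abs_if split: if_splits)
    with * show "\<not> reach k (rim N) A" unfolding reach_def by blast
  qed
  also have "\<dots> \<le> (1 / 8) ^ 4"
    using assms(3) by (simp add: pr_not)
  finally have "q ^ 4 \<le> (1 / 8) ^ 4"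
    by (simp add: power4_eq_xxxx mult_ac)
  then have q8: "q \<le> 1 / 8"
    using q0 by (simp add: power_mono_iff del: power_divide)
  have "?P (\<lambda>A. \<not> lr N A) \<le> ?P (\<lambda>A. (\<not> reach k ?L A \<or> \<not> reach k ?R A) \<or> two_arms k N A)"
  proof (intro pr_mono assms)
    fix A assume "\<not> lr N A"
    show "(\<not> reach k ?L A \<or> \<not> reach k ?R A) \<or> two_arms k N A"
    proof (rule ccontr)
      assume *: "\<not> ?thesis"
      then obtain u w where uw: "u \<in> block k" "w \<in> block N" "fst w = - int N" "con A u w"
        unfolding reach_def by blast
      from * obtain v z where vz: "v \<in> block k" "z \<in> block N" "fst z = int N" "con A v z"
        unfolding reach_def by blast
      have "w \<in> rim N" "z \<in> rim N" using uw vz by (auto simp: rim_def)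
      then have "con A u v" using * uw vz unfolding two_arms_def by blast
      then have "con A w z" using uw vz con_sym con_trans by blast
      then show False using \<open>\<not> lr N A\<close> uw vz unfolding lr_def by blast
    qed
  qed
  also have "\<dots> \<le> (?P (\<lambda>A. \<not> reach k ?L A) + ?P (\<lambda>A. \<not> reach k ?R A)) + ?P (two_arms k N)"
    using assms by (intro order_trans[OF pr_disj_le] add_mono pr_disj_le) auto
  also have "\<dots> \<le> 1 / 4 + ?P (two_arms k N)"
    using q[of ?L] q[of ?R] q8 by auto
  finally show ?thesis by (simp add: pr_not)
qed

text \<open>If \<open>phi S q \<ge> 1\<close> for all \<open>S\<close>, open clusters percolate between \<open>q\<close> and \<open>1 / 2\<close>, and for a suitable
  parameter in this range two distant arms are joined; then crossings of large boxes would be more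
  likely than \<open>1 / 2\<close>.\<close>

lemma phi_subcritical:
  assumes "0 < q" "q < 1 / 2"
  shows "\<exists>S. finite S \<and> 0 \<in> S \<and> phi S q < 1"
proof (rule ccontr)
  assume "\<not> ?thesis"
  then have phi: "1 \<le> phi S q" if "finite S" "0 \<in> S" for S
    using that by force
  \<comment> \<open>The midpoint leaves room on both sides: arms become uniformly likely between
    \<open>q\<close> and \<open>p\<close>, and \<open>\<xi>\<close> is found between
    \<open>p\<close> and \<open>1 / 2\<close>.\<close>
  define p where "p = (q + 1 / 2) / 2"
  have p: "q < p" "p < 1 / 2" using assms by (auto simp: p_def)
  define c where "c = (p - q) / (1 + (p - q))"
  have "0 < c" using p by (simp add: c_def)
  moreover have "c \<le> theta n p" for n
    unfolding c_def using assms p phi by (intro theta_lower_bound) auto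
  ultimately obtain k where k: "\<And>N. k \<le> N \<Longrightarrow> 1 - (1 / 8) ^ 4 \<le> pr (block N) p (reach k (rim N))"
    using reach_likely[of p c "(1 / 8) ^ 4"] assms p by auto
  \<comment> \<open>Since \<open>p\<close> is below both \<open>\<xi>\<close> and
    \<open>1 - \<xi>\<close>, this finite-energy factor is valid wherever \<open>\<xi>\<close>
    falls.\<close>
  define \<kappa> where "\<kappa> = p ^ card (block k)"
  define K where "K = real (card (block k)) * (5 * (1 + 1 / (1 / 2 - p)))"
  have "0 < \<kappa>" using assms p by (simp add: \<kappa>_def)
  \<comment> \<open>This makes the two-arm probability at most \<open>1 / 8\<close>, so the crossing
    probability is at least \<open>3 / 4 - 1 / 8 = 5 / 8\<close>.\<close>
  obtain M where M: "8 * K / \<kappa> < real M" using reals_Archimedean2 by blast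
  have "0 \<le> K" using p by (simp add: K_def)
  then have "0 < real M" using M \<open>0 < \<kappa>\<close> by (smt (verit) divide_nonneg_pos)
  then obtain \<xi> where \<xi>: "p < \<xi>" "\<xi> < 1 / 2" "mu (3 * M) \<xi> \<le> 5 * (1 + 1 / (1 / 2 - p)) / real M"
    using mu_small[of p "1 / 2" M] assms p by auto
  define N where "N = 3 * M + k"
  have \<xi>01: "0 \<le> \<xi>" "\<xi> \<le> 1" using \<xi> p assms by auto
  have "\<kappa> * pr (block N) \<xi> (two_arms k N) \<le> real (card (block k)) * mu (3 * M) \<xi>"
    unfolding \<kappa>_def N_def using \<xi> p assms \<open>0 < real M\<close> by (intro two_arms_le) auto
  also have "\<dots> \<le> real (card (block k)) * (5 * (1 + 1 / (1 / 2 - p)) / real M)"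
    using \<xi>(3) by (rule mult_left_mono) simp
  also have "\<dots> = K / real M" by (simp add: K_def)
  also have "\<dots> \<le> \<kappa> / 8"
    using M \<open>0 < \<kappa>\<close> \<open>0 < real M\<close> by (simp add: field_simps)
  finally have "\<kappa> * pr (block N) \<xi> (two_arms k N) \<le> \<kappa> * (1 / 8)" by simp
  then have "pr (block N) \<xi> (two_arms k N) \<le> 1 / 8"
    using \<open>0 < \<kappa>\<close> by (subst (asm) mult_le_cancel_left_pos)
  moreover have "pr (block N) p (reach k (rim N)) \<le> pr (block N) \<xi> (reach k (rim N))"
    using p assms \<xi> by (intro pr_mono_p) (auto intro: reach_mono)
  then have "1 - (1 / 8) ^ 4 \<le> pr (block N) \<xi> (reach k (rim N))"
    using k[of N] by (simp add: N_def)
  then have "3 / 4 - pr (block N) \<xi> (two_arms k N) \<le> pr (block N) \<xi> (lr N)"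
    using \<xi>01 by (intro lr_likely)
  moreover have "pr (block N) \<xi> (lr N) \<le> 1 / 2"
    using \<xi> \<xi>01 by (intro lr_half) auto
  ultimately show False by simp
qed

text \<open>Simon's inequality gains a factor \<open>r < 1\<close> every \<open>d = L + 1\<close>
  steps; the rate per step is the \<open>d\<close>-th root of \<open>r\<close>.\<close>

lemma exponential_decay:
  assumes "0 < q" "q < 1 / 2"
  obtains C s where "0 \<le> C" "0 \<le> s" "s < 1" "\<And>n. theta n q \<le> C * s ^ n"
proof -
  obtain S where S: "finite S" "0 \<in> S" "phi S q < 1"
    using phi_subcritical[OF assms] by blast
  obtain L where L: "S \<subseteq> block L"
  proof -
    define L where "L = Max ((\<lambda>v. nat (max \<bar>fst v\<bar> \<bar>snd v\<bar>)) ` S)"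
    have "v \<in> block L" if "v \<in> S" for v
    proof -
      have "nat (max \<bar>fst v\<bar> \<bar>snd v\<bar>) \<le> L"
        unfolding L_def using that S(1) by (intro Max_ge) auto
      then show ?thesis unfolding mem_block by linarith
    qed
    then show ?thesis using that by blast
  qed
  have q: "0 \<le> q" "q \<le> 1" using assms by auto
  \<comment> \<open>The maximum with \<open>1 / 2\<close> keeps \<open>r\<close> positive, for the
    factor \<open>1 / r\<close> below.\<close>
  define r where "r = max (phi S q) (1 / 2)"
  have r: "0 < r" "r < 1" "phi S q \<le> r" using S by (auto simp: r_def)
  define d where "d = L + 1"
  have step: "theta (n + d) q \<le> r * theta n q" for n
    using simon_inequality[OF S(2) L q, of n] mult_right_mono[OF r(3) theta_nonneg[OF q, of n]]
    by (simp add: d_def)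
  have "theta n q \<le> r ^ (n div d)" for n
  proof (induction n rule: less_induct)
    case (less n)
    show ?case
    proof (cases "n < d")
      case True
      then show ?thesis using theta_le_1[OF q] by simp
    next
      case False
      then have n: "n = (n - d) + d" by simp
      have "theta n q \<le> r * theta (n - d) q" using step[of "n - d"] n by simp
      also have "\<dots> \<le> r * r ^ ((n - d) div d)"
        using less[of "n - d"] False r by (intro mult_left_mono) (auto simp: d_def)
      also have "\<dots> = r ^ (n div d)"
        using False by (simp add: le_div_geq d_def)
      finally show ?thesis .
    qed
  qed
  moreover define s where "s = root d r"
  have "0 < d" by (simp add: d_def)
  then have s: "0 \<le> s" "s < 1" "s ^ d = r"
    using r by (auto simp: s_def)
  \<comment> \<open>Rounding the exponent down loses less than one factor \<open>r\<close>, which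
    \<open>1 / r\<close> restores.\<close>
  have "r ^ (n div d) \<le> (1 / r) * s ^ n" for n
  proof -
    have "r ^ (n div d) * r \<le> r ^ (n div d) * s ^ (n mod d)"
    proof (rule mult_left_mono)
      have "s ^ d \<le> s ^ (n mod d)"
        using s by (intro power_decreasing) (auto simp: d_def less_imp_le)
      then show "r \<le> s ^ (n mod d)" using s by simp
    qed (use r in simp)
    also have "\<dots> = s ^ (d * (n div d) + n mod d)"
      by (simp only: s(3) power_add power_mult)
    also have "\<dots> = s ^ n" by (simp only: mult_div_mod_eq)
    finally show ?thesis using r by (simp add: field_simps)
  qed
  ultimately have "theta n q \<le> (1 / r) * s ^ n" for n
    using order_trans by blast
  with r s show ?thesis by (intro that[of "1 / r" s]) auto
qed

section \<open>Percolation in infinite volume\<close>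

definition hcross :: "int \<Rightarrow> int \<Rightarrow> int \<Rightarrow> int \<Rightarrow> site set \<Rightarrow> bool" where
  "hcross x1 x2 y1 y2 A \<longleftrightarrow>
     (\<exists>u w. con (A \<inter> ({x1..x2} \<times> {y1..y2})) u w \<and> fst u = x1 \<and> fst w = x2)"

definition vcross :: "int \<Rightarrow> int \<Rightarrow> int \<Rightarrow> int \<Rightarrow> site set \<Rightarrow> bool" where
  "vcross x1 x2 y1 y2 A \<longleftrightarrow> hcross y1 y2 x1 x2 (prod.swap ` A)"

lemma hcross_local:
  assumes "{x1..x2} \<times> {y1..y2} \<subseteq> V"
  shows "hcross x1 x2 y1 y2 (A \<inter> V) \<longleftrightarrow> hcross x1 x2 y1 y2 A"
proof -
  have "A \<inter> V \<inter> ({x1..x2} \<times> {y1..y2}) = A \<inter> ({x1..x2} \<times> {y1..y2})"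
    using assms by blast
  then show ?thesis by (simp only: hcross_def)
qed

lemma vcross_local:
  assumes "{x1..x2} \<times> {y1..y2} \<subseteq> V"
  shows "vcross x1 x2 y1 y2 (A \<inter> V) \<longleftrightarrow> vcross x1 x2 y1 y2 A"
proof -
  have "prod.swap ` (A \<inter> V) = prod.swap ` A \<inter> prod.swap ` V"
    by (intro image_Int) simp
  moreover have "{y1..y2} \<times> {x1..x2} \<subseteq> prod.swap ` V"
    using assms by (force simp: image_iff)
  ultimately show ?thesis
    using hcross_local by (simp only: vcross_def)
qed

lemma vcrossD:
  assumes "vcross x1 x2 y1 y2 A"
  obtains s t where "con (A \<inter> ({x1..x2} \<times> {y1..y2})) s t" "snd s = y1" "snd t = y2"
proof -
  obtain s t where st: "con (prod.swap ` A \<inter> ({y1..y2} \<times> {x1..x2})) s t" "fst s = y1" "fst t = y2"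
    using assms unfolding vcross_def hcross_def by blast
  then have "con (prod.swap ` (prod.swap ` A \<inter> ({y1..y2} \<times> {x1..x2}))) (prod.swap s) (prod.swap t)"
    by (intro con_image adj_swap)
  moreover have "prod.swap ` (prod.swap ` A \<inter> ({y1..y2} \<times> {x1..x2})) \<subseteq> A \<inter> ({x1..x2} \<times> {y1..y2})"
    by auto
  ultimately have "con (A \<inter> ({x1..x2} \<times> {y1..y2})) (prod.swap s) (prod.swap t)"
    by (rule con_mono)
  then show ?thesis using st by (intro that) auto
qed

text \<open>By the Hex lemma the obstacle is a closed path from bottom to top, hence a closed arm of
  length \<open>l\<close> from one of the \<open>k + 1\<close> bottom sites. Closed sites have
  density \<open>1 - p\<close>.\<close>

lemma pr_no_hcross:
  assumes "0 \<le> p" "p \<le> 1" "{x..x + int k} \<times> {y..y + int l} \<subseteq> block N"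
    and "\<And>i. x \<le> i \<Longrightarrow> i \<le> x + int k \<Longrightarrow> shift (i, y) (block l) \<subseteq> block N"
  shows "pr (block N) p (\<lambda>A. \<not> hcross x (x + int k) y (y + int l) A) \<le> real (k + 1) * theta l (1 - p)"
proof -
  let ?V = "block N" and ?R = "{x..x + int k} \<times> {y..y + int l}" and ?I = "{x..x + int k}"
  have "pr ?V p (\<lambda>A. \<not> hcross x (x + int k) y (y + int l) A) \<le>
      pr ?V p (\<lambda>A. \<exists>i\<in>?I. arm (i, y) l (?V - A))"
  proof (intro pr_mono assms)
    fix A assume "\<not> hcross x (x + int k) y (y + int l) A"
    then obtain u w where uw: "con (?R - A) u w" "snd u = y" "snd w = y + int l"
      using hex_exists[of A x k y l] unfolding hcross_def by blast
    have "con (?V - A) u w"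
      using assms(3) by (intro con_mono[OF uw(1)]) blast
    moreover have "w \<notin> shift u (block l) \<or> w \<in> shift u (rim l)"
      using uw unfolding mem_shift_rim mem_shift_block by linarith
    ultimately have "arm u l (?V - A)" by (rule armI)
    moreover have "u \<in> ?R" using uw(1) con_in by blast
    then have "fst u \<in> ?I" "u = (fst u, y)" using uw(2) by auto
    ultimately show "\<exists>i\<in>?I. arm (i, y) l (?V - A)" by metis
  qed
  also have "\<dots> \<le> (\<Sum>i\<in>?I. pr ?V p (\<lambda>A. arm (i, y) l (?V - A)))"
    using assms by (intro pr_Bex_le) auto
  also have "\<dots> = (\<Sum>i\<in>?I. theta l (1 - p))"
  proof (intro sum.cong refl)
    fix i assume i: "i \<in> ?I"
    have "pr ?V p (\<lambda>A. arm (i, y) l (?V - A)) = pr ?V (1 - p) (\<lambda>A. arm (i, y) l (?V - (?V - A)))"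
      unfolding pr_def by (rule expec_compl) simp
    also have "\<dots> = pr ?V (1 - p) (arm (i, y) l)"
      by (intro pr_cong) (simp add: double_diff)
    also have "\<dots> = theta l (1 - p)"
      using assms(4)[of i] i by (intro pr_arm) auto
    finally show "pr ?V p (\<lambda>A. arm (i, y) l (?V - A)) = theta l (1 - p)" .
  qed
  finally show ?thesis by (simp add: nat_add_distrib)
qed

text \<open>Four long crossings around \<open>block n\<close>. Their length \<open>8 * n\<close>
  makes neighbouring scales overlap: a horizontal crossing at scale \<open>n\<close> spans the
  columns \<open>2 * n\<close> to \<open>4 * n\<close> of a vertical one at scale
  \<open>2 * n\<close>.\<close>

definition good :: "nat \<Rightarrow> site set \<Rightarrow> bool" where
  "good n A \<longleftrightarrow>
     hcross (- 4 * int n) (4 * int n) (int n) (2 * int n) A \<and>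
     hcross (- 4 * int n) (4 * int n) (- 2 * int n) (- int n) A \<and>
     vcross (int n) (2 * int n) (- 4 * int n) (4 * int n) A \<and>
     vcross (- 2 * int n) (- int n) (- 4 * int n) (4 * int n) A"

lemma good_local: "good n A \<longleftrightarrow> good n (A \<inter> block (6 * n))"
proof -
  have "{- 4 * int n..4 * int n} \<times> {int n..2 * int n} \<subseteq> block (6 * n)"
    "{- 4 * int n..4 * int n} \<times> {- 2 * int n..- int n} \<subseteq> block (6 * n)"
    "{int n..2 * int n} \<times> {- 4 * int n..4 * int n} \<subseteq> block (6 * n)"
    "{- 2 * int n..- int n} \<times> {- 4 * int n..4 * int n} \<subseteq> block (6 * n)"
    unfolding block_def by (intro Sigma_mono; auto)+
  then show ?thesis
    unfolding good_def by (simp only: hcross_local vcross_local)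
qed

lemma pr_not_good:
  assumes "0 \<le> p" "p \<le> 1"
  shows "pr (block (6 * n)) p (\<lambda>A. \<not> good n A) \<le> 4 * (real (8 * n + 1) * theta n (1 - p))"
proof -
  let ?V = "block (6 * n)" and ?e = "real (8 * n + 1) * theta n (1 - p)"
  have h: "pr ?V p (\<lambda>A. \<not> hcross (- 4 * int n) (4 * int n) y (y + int n) A) \<le> ?e"
    if "- 2 * int n \<le> y" "y \<le> int n" for y
  proof -
    have "{- 4 * int n..4 * int n} \<times> {y..y + int n} \<subseteq> ?V"
      unfolding block_def using that by (intro Sigma_mono; auto)
    moreover have "shift (i, y) (block n) \<subseteq> ?V" if "- 4 * int n \<le> i" "i \<le> 4 * int n" for i
      unfolding subset_iff mem_shift_block mem_block fst_conv snd_conv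
      using that \<open>- 2 * int n \<le> y\<close> \<open>y \<le> int n\<close> by (intro allI impI) linarith
    moreover have "- 4 * int n + int (8 * n) = 4 * int n" by simp
    ultimately show ?thesis
      using pr_no_hcross[OF assms, of "- 4 * int n" "8 * n" y n "6 * n"] by simp
  qed
  have v: "pr ?V p (\<lambda>A. \<not> vcross y (y + int n) (- 4 * int n) (4 * int n) A) =
      pr ?V p (\<lambda>A. \<not> hcross (- 4 * int n) (4 * int n) y (y + int n) A)" for y
    using expec_image[of prod.swap ?V p "\<lambda>A. of_bool (\<not> hcross (- 4 * int n) (4 * int n) y (y + int n) A)"]
    by (simp add: pr_def vcross_def swap_block)
  let ?h = "\<lambda>y A. \<not> hcross (- 4 * int n) (4 * int n) y (y + int n) A"
  let ?v = "\<lambda>y A. \<not> vcross y (y + int n) (- 4 * int n) (4 * int n) A"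
  have "pr ?V p (\<lambda>A. \<not> good n A) \<le>
      pr ?V p (\<lambda>A. (?h (int n) A \<or> ?h (- 2 * int n) A) \<or> (?v (int n) A \<or> ?v (- 2 * int n) A))"
    using assms by (intro pr_mono) (auto simp: good_def)
  also have "\<dots> \<le> (pr ?V p (?h (int n)) + pr ?V p (?h (- 2 * int n))) +
      (pr ?V p (?v (int n)) + pr ?V p (?v (- 2 * int n)))"
    using assms by (intro order_trans[OF pr_disj_le] add_mono pr_disj_le)
  also have "\<dots> \<le> (?e + ?e) + (?e + ?e)"
    unfolding v by (intro add_mono h) auto
  finally show ?thesis by (simp add: algebra_simps)
qed

text \<open>Here \<open>crossings_meet\<close> is applied to the clusters of \<open>u\<close> in
  \<open>P\<close> and of \<open>s\<close> in \<open>Q\<close>, so that the common site is connected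
  to both.\<close>

lemma paths_meet:
  assumes "con P u w" "\<And>v. v \<in> P \<Longrightarrow> v \<in> A \<and> y1 \<le> snd v \<and> snd v \<le> y2" "fst u \<le> x1" "x2 \<le> fst w"
    and "con Q s t" "\<And>v. v \<in> Q \<Longrightarrow> v \<in> A \<and> x1 \<le> fst v \<and> fst v \<le> x2" "snd s \<le> y1" "y2 \<le> snd t"
  shows "con A u s"
proof -
  have "cluster P u \<inter> cluster Q s \<noteq> {}"
    using assms cluster_subset[of P u] cluster_subset[of Q s]
    by (intro crossings_meet[OF con_cluster[OF assms(1)] _ _ _ con_cluster[OF assms(5)],
          where ?x1.0 = x1 and ?x2.0 = x2 and ?y1.0 = y1 and ?y2.0 = y2]) blast+
  then obtain v where v: "con P u v" "con Q s v" by (auto simp: cluster_def)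
  have "P \<subseteq> A" "Q \<subseteq> A" using assms(2,6) by blast+
  then have "con A u v" "con A s v" using v con_mono by blast+
  then show ?thesis using con_sym con_trans by blast
qed

definition inf_cluster :: "site set \<Rightarrow> site \<Rightarrow> bool" where
  "inf_cluster A v \<longleftrightarrow> v \<in> A \<and> infinite (cluster A v)"

text \<open>A vertical crossing at scale \<open>2 * n\<close> meets the horizontal crossings at
  scales \<open>n\<close> and \<open>2 * n\<close>, so those along dyadic scales are all connected.
  Their starting points lie in different columns.\<close>

lemma inf_cluster_exists:
  assumes "\<And>n. n0 \<le> n \<Longrightarrow> good n A"
  shows "\<exists>v. inf_cluster A v"
proof -
  define N where "N j = (n0 + 1) * 2 ^ j" for j :: nat
  have N: "n0 \<le> N j" "0 < N j" for j
  proof -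
    have "(n0 + 1) * 1 \<le> N j" unfolding N_def by (intro mult_left_mono) auto
    then show "n0 \<le> N j" "0 < N j" by auto
  qed
  let ?T = "\<lambda>n. {- 4 * int n..4 * int n} \<times> {int n..2 * int n}"
  let ?R = "\<lambda>n. {int n..2 * int n} \<times> {- 4 * int n..4 * int n}"
  have "\<exists>u w. con (A \<inter> ?T n) u w \<and> fst u = - 4 * int n \<and> fst w = 4 * int n" if "n0 \<le> n" for n
    using assms[OF that] unfolding good_def hcross_def by blast
  then obtain u w where uw: "\<And>n. n0 \<le> n \<Longrightarrow> con (A \<inter> ?T n) (u n) (w n)"
    "\<And>n. n0 \<le> n \<Longrightarrow> fst (u n) = - 4 * int n" "\<And>n. n0 \<le> n \<Longrightarrow> fst (w n) = 4 * int n"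
    by metis
  have "\<exists>s t. con (A \<inter> ?R n) s t \<and> snd s = - 4 * int n \<and> snd t = 4 * int n" if "n0 \<le> n" for n
    using assms[OF that] vcrossD unfolding good_def by metis
  then obtain s t where st: "\<And>n. n0 \<le> n \<Longrightarrow> con (A \<inter> ?R n) (s n) (t n)"
    "\<And>n. n0 \<le> n \<Longrightarrow> snd (s n) = - 4 * int n" "\<And>n. n0 \<le> n \<Longrightarrow> snd (t n) = 4 * int n"
    by metis
  have us: "con A (u n) (s m)" if "n0 \<le> n" "n0 \<le> m" "m = n \<or> m = 2 * n" for n m
    using that uw[OF that(1)] st[OF that(2)]
    by (intro paths_meet[OF uw(1)[OF that(1)] _ _ _ st(1)[OF that(2)],
          where ?x1.0 = "int m" and ?x2.0 = "2 * int m" and ?y1.0 = "int n" and ?y2.0 = "2 * int n"]) auto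
  have step: "con A (u (N j)) (u (N (Suc j)))" for j
  proof (rule con_trans[OF _ con_sym])
    show "con A (u (N j)) (s (N (Suc j)))" "con A (u (N (Suc j))) (s (N (Suc j)))"
      using us[OF N(1)[of j] N(1)[of "Suc j"]] us[OF N(1)[of "Suc j"] N(1)[of "Suc j"]]
      by (simp_all add: N_def)
  qed
  have uA: "u n \<in> A" if "n0 \<le> n" for n
    using uw(1)[OF that] con_in by blast
  have all: "con A (u (N 0)) (u (N j))" for j
  proof (induction j)
    case 0
    show ?case by (intro con_refl uA N)
  next
    case (Suc j)
    then show ?case by (rule con_trans[OF _ step])
  qed
  have "inj (\<lambda>j. u (N j))"
  proof (rule injI)
    fix i j assume "u (N i) = u (N j)"
    then have "- 4 * int (N i) = - 4 * int (N j)"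
      using uw(2)[OF N(1)[of i]] uw(2)[OF N(1)[of j]] by metis
    then have "N i = N j" by simp
    then have "2 ^ i = (2 :: nat) ^ j" unfolding N_def mult_cancel1 by simp
    then show "i = j" by simp
  qed
  then have "infinite (range (\<lambda>j. u (N j)))"
    by (rule range_inj_infinite)
  moreover have "range (\<lambda>j. u (N j)) \<subseteq> cluster A (u (N 0))"
    using all by (auto simp: cluster_def)
  ultimately have "infinite (cluster A (u (N 0)))"
    using finite_subset by blast
  then show ?thesis
    using uA N unfolding inf_cluster_def by blast
qed

text \<open>At a scale where both sites lie in \<open>block n\<close>, the four crossings are
  connected to each other. An infinite cluster must leave \<open>block (2 * n)\<close>, and
  whichever side it uses, it traverses a strip and meets the crossing there.\<close>

lemma inf_cluster_unique:
  assumes "\<And>n. n0 \<le> n \<Longrightarrow> good n A" "inf_cluster A a" "inf_cluster A b"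
  shows "con A a b"
proof -
  define n where "n = n0 + nat \<bar>fst a\<bar> + nat \<bar>snd a\<bar> + nat \<bar>fst b\<bar> + nat \<bar>snd b\<bar>"
  have ab: "a \<in> block n" "b \<in> block n" and "n0 \<le> n"
    by (simp_all add: n_def mem_block)
  have good: "good n A" using assms(1) \<open>n0 \<le> n\<close> by blast
  let ?I = "{- 4 * int n..4 * int n}" and ?J = "{int n..2 * int n}" and ?K = "{- 2 * int n..- int n}"
  obtain uT wT where T: "con (A \<inter> (?I \<times> ?J)) uT wT" "fst uT = - 4 * int n" "fst wT = 4 * int n"
    using good unfolding good_def hcross_def by blast
  obtain uB wB where B: "con (A \<inter> (?I \<times> ?K)) uB wB" "fst uB = - 4 * int n" "fst wB = 4 * int n"
    using good unfolding good_def hcross_def by blast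
  obtain sR tR where R: "con (A \<inter> (?J \<times> ?I)) sR tR" "snd sR = - 4 * int n" "snd tR = 4 * int n"
    using good vcrossD unfolding good_def by metis
  obtain sL tL where L: "con (A \<inter> (?K \<times> ?I)) sL tL" "snd sL = - 4 * int n" "snd tL = 4 * int n"
    using good vcrossD unfolding good_def by metis
  have TR: "con A uT sR"
    using T R by (intro paths_meet[OF T(1) _ _ _ R(1),
      where ?x1.0 = "int n" and ?x2.0 = "2 * int n" and ?y1.0 = "int n" and ?y2.0 = "2 * int n"]) auto
  have TL: "con A uT sL"
    using T L by (intro paths_meet[OF T(1) _ _ _ L(1),
      where ?x1.0 = "- 2 * int n" and ?x2.0 = "- int n" and ?y1.0 = "int n" and ?y2.0 = "2 * int n"]) auto
  have BR: "con A uB sR"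
    using B R by (intro paths_meet[OF B(1) _ _ _ R(1),
      where ?x1.0 = "int n" and ?x2.0 = "2 * int n" and ?y1.0 = "- 2 * int n" and ?y2.0 = "- int n"]) auto
  have "con A v uT" if v: "inf_cluster A v" "v \<in> block n" for v
  proof -
    have v_block: "- int n \<le> fst v" "fst v \<le> int n" "- int n \<le> snd v" "snd v \<le> int n"
      using v(2) unfolding mem_block by auto
    have "\<not> cluster A v \<subseteq> block (2 * n)"
      using v(1) finite_subset[OF _ finite_block] unfolding inf_cluster_def by blast
    then obtain w0 where w0: "con A v w0" "w0 \<notin> block (2 * n)"
      by (auto simp: cluster_def)
    have "v \<in> block (2 * n)" using v(2) block_mono[of n "2 * n"] by auto
    then obtain w where w: "w \<in> rim (2 * n)" "con (A \<inter> block (2 * n)) v w"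
      using con_rim[OF w0(1), of 0 "2 * n"] w0(2) by auto
    have in_block: "x \<in> A \<and> - 2 * int n \<le> fst x \<and> fst x \<le> 2 * int n \<and>
        - 2 * int n \<le> snd x \<and> snd x \<le> 2 * int n" if "x \<in> A \<inter> block (2 * n)" for x
      using that by (auto simp: mem_block abs_le_iff)
    note w' = con_sym[OF w(2)]
    have vw: "con A v w" using w(2) con_mono by blast
    have "fst w = 2 * int n \<or> fst w = - 2 * int n \<or> snd w = 2 * int n \<or> snd w = - 2 * int n"
      using w(1) unfolding mem_rim by auto
    then show ?thesis
    proof (elim disjE)
      assume "fst w = 2 * int n"
      then have "con A v sR"
        using R v_block in_block by (intro paths_meet[OF w(2) _ _ _ R(1),
          where ?x1.0 = "int n" and ?x2.0 = "2 * int n" and ?y1.0 = "- 2 * int n" and ?y2.0 = "2 * int n"]) auto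
      then show ?thesis by (rule con_trans[OF _ con_sym[OF TR]])
    next
      assume "fst w = - 2 * int n"
      then have "con A w sL"
        using L v_block in_block by (intro paths_meet[OF w' _ _ _ L(1),
          where ?x1.0 = "- 2 * int n" and ?x2.0 = "- int n" and ?y1.0 = "- 2 * int n" and ?y2.0 = "2 * int n"]) auto
      then have "con A w uT" by (rule con_trans[OF _ con_sym[OF TL]])
      with vw show ?thesis by (rule con_trans)
    next
      assume "snd w = 2 * int n"
      then have "con A uT v"
        using T v_block in_block by (intro paths_meet[OF T(1) _ _ _ w(2),
          where ?x1.0 = "- 2 * int n" and ?x2.0 = "2 * int n" and ?y1.0 = "int n" and ?y2.0 = "2 * int n"]) auto
      then show ?thesis by (rule con_sym)
    next
      assume "snd w = - 2 * int n"
      then have "con A uB w"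
        using B v_block in_block by (intro paths_meet[OF B(1) _ _ _ w',
          where ?x1.0 = "- 2 * int n" and ?x2.0 = "2 * int n" and ?y1.0 = "- 2 * int n" and ?y2.0 = "- int n"]) auto
      from con_trans[OF con_trans[OF con_sym[OF this] BR] con_sym[OF TR]]
      show ?thesis by (rule con_trans[OF vw])
    qed
  qed
  from this[OF assms(2) ab(1)] this[OF assms(3) ab(2)] show ?thesis
    by (rule con_trans[OF _ con_sym])
qed

section \<open>From the complex plane to lattice coordinates\<close>

definition emb :: "site \<Rightarrow> complex" where
  "emb u = of_int (fst u) + of_int (snd u) * cis (pi / 3)"

definition cfg :: "(complex \<Rightarrow> bool) \<Rightarrow> site set" where
  "cfg \<omega> = {u. \<omega> (emb u)}"

lemma emb_Re_Im: "Re (emb u) = of_int (fst u) + of_int (snd u) / 2" "Im (emb u) = of_int (snd u) * (sqrt 3 / 2)"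
  by (simp_all add: emb_def cos_60 sin_60)

lemma inj_emb: "inj emb"
proof (rule injI)
  fix u v assume "emb u = emb v"
  then have "Re (emb u) = Re (emb v)" "Im (emb u) = Im (emb v)" by simp_all
  then show "u = v" by (simp add: emb_Re_Im prod_eq_iff)
qed

lemma range_emb: "range emb = tri_lattice"
proof (intro subset_antisym subsetI)
  fix z assume "z \<in> tri_lattice"
  then obtain k l where "z = of_int k + of_int l * cis (pi / 3)"
    by (auto simp: tri_lattice_def)
  then have "z = emb (k, l)" by (simp add: emb_def)
  then show "z \<in> range emb" by blast
qed (auto simp: emb_def tri_lattice_def)

text \<open>The form is the squared distance in lattice coordinates. Four times it equals
  \<open>(2 * x + y)\<close> squared plus three times \<open>y\<close> squared, which leaves only
  coordinates in \<open>{-1, 0, 1}\<close>.\<close>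

lemma unit_quadratic_form:
  fixes a b :: int
  assumes "a * a + a * b + b * b = 1"
  shows "(a, b) \<in> {(1, 0), (-1, 0), (0, 1), (0, -1), (1, -1), (-1, 1)}"
proof -
  have bound: "\<bar>y\<bar> \<le> 1" if "x * x + x * y + y * y = 1" for x y :: int
  proof (rule ccontr)
    assume "\<not> \<bar>y\<bar> \<le> 1"
    then have "2 * 2 \<le> \<bar>y\<bar> * \<bar>y\<bar>" by (intro mult_mono) auto
    then have "4 \<le> y * y" by simp
    moreover have "0 \<le> (2 * x + y) * (2 * x + y)" by simp
    then have "0 \<le> 4 * (x * x + x * y + y * y) - 3 * (y * y)" by (simp add: algebra_simps)
    ultimately show False using that by simp
  qed
  have "\<bar>a\<bar> \<le> 1" "\<bar>b\<bar> \<le> 1"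
    using bound[of b a] bound[of a b] assms by (simp_all add: algebra_simps)
  then have "a \<in> {-1, 0, 1}" "b \<in> {-1, 0, 1}" by auto
  then show ?thesis using assms by auto
qed

lemma tri_adj_emb: "tri_adj (emb u) (emb v) \<longleftrightarrow> adj u v"
proof -
  define a b where "a = fst v - fst u" and "b = snd v - snd u"
  have "dist (emb u) (emb v) = 1 \<longleftrightarrow> (cmod (emb v - emb u))\<^sup>2 = 1"
    by (simp add: dist_commute dist_norm power2_eq_1_iff norm_minus_commute) (smt (verit) norm_ge_zero)
  also have "(cmod (emb v - emb u))\<^sup>2 = (of_int a + of_int b / 2)\<^sup>2 + (of_int b * (sqrt 3 / 2))\<^sup>2"
  proof -
    have "Re (emb v - emb u) = of_int a + of_int b / 2" "Im (emb v - emb u) = of_int b * (sqrt 3 / 2)"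
      by (simp_all add: emb_Re_Im a_def b_def field_simps)
    then show ?thesis by (simp only: cmod_power2)
  qed
  also have "\<dots> = of_int (a * a + a * b + b * b)"
    by (simp add: power2_eq_square field_simps)
  also have "\<dots> = 1 \<longleftrightarrow> a * a + a * b + b * b = 1"
    by (simp only: of_int_eq_1_iff)
  also have "\<dots> \<longleftrightarrow> (a, b) \<in> {(1, 0), (-1, 0), (0, 1), (0, -1), (1, -1), (-1, 1)}"
    using unit_quadratic_form by auto
  also have "\<dots> \<longleftrightarrow> adj u v"
  proof -
    obtain i j k l where "u = (i, j)" "v = (k, l)" by (cases u; cases v)
    then show ?thesis
      unfolding a_def b_def by (simp only: fst_conv snd_conv adj.simps insert_iff empty_iff prod.inject) smt
  qed
  finally show ?thesis
    using range_emb by (auto simp: tri_adj_def)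
qed

lemma open_adj_emb: "open_adj \<omega> (emb u) (emb v) \<longleftrightarrow> u \<in> cfg \<omega> \<and> v \<in> cfg \<omega> \<and> adj u v"
  using range_emb by (auto simp: open_adj_def open_sites_def cfg_def tri_adj_emb)

lemma open_sites_emb: "open_sites \<omega> = emb ` cfg \<omega>"
  using range_emb by (auto simp: open_sites_def cfg_def)

lemma clusters_emb: "clusters \<omega> = (\<lambda>u. emb ` cluster (cfg \<omega>) u) ` cfg \<omega>"
proof -
  have "{w. (open_adj \<omega>)\<^sup>*\<^sup>* (emb u) w} = emb ` cluster (cfg \<omega>) u" if u: "u \<in> cfg \<omega>" for u
  proof (intro subset_antisym subsetI)
    fix w assume "w \<in> {w. (open_adj \<omega>)\<^sup>*\<^sup>* (emb u) w}"
    then have "(open_adj \<omega>)\<^sup>*\<^sup>* (emb u) w" by simp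
    then show "w \<in> emb ` cluster (cfg \<omega>) u"
    proof (induction rule: rtranclp_induct)
      case base
      then show ?case using u by (auto simp: cluster_def con_refl)
    next
      case (step y z)
      then obtain v where v: "y = emb v" "con (cfg \<omega>) u v" by (auto simp: cluster_def)
      have "z \<in> range emb" using step(2) unfolding range_emb open_adj_def tri_adj_def by blast
      then obtain v' where "z = emb v'" by blast
      with step(2) v show ?case
        using con_step by (auto simp: open_adj_emb cluster_def)
    qed
  next
    fix w assume "w \<in> emb ` cluster (cfg \<omega>) u"
    then obtain v where "w = emb v" "con (cfg \<omega>) u v" by (auto simp: cluster_def)
    from this(2) have "(open_adj \<omega>)\<^sup>*\<^sup>* (emb u) (emb v)"
    proof (induction rule: con_induct)
      case (step v v')
      then have "open_adj \<omega> (emb v) (emb v')"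
        using con_in by (auto simp: open_adj_emb)
      with step.IH show ?case by (rule rtranclp.rtrancl_into_rtrancl)
    qed simp
    then show "w \<in> {w. (open_adj \<omega>)\<^sup>*\<^sup>* (emb u) w}" using \<open>w = emb v\<close> by simp
  qed
  then have "(\<lambda>u. {w. (open_adj \<omega>)\<^sup>*\<^sup>* (emb u) w}) ` cfg \<omega> = (\<lambda>u. emb ` cluster (cfg \<omega>) u) ` cfg \<omega>"
    by (rule image_cong[OF refl])
  then show ?thesis
    unfolding clusters_def open_sites_emb by (simp add: Setcompr_eq_image image_image)
qed

lemma infinite_cluster_iff:
  "C \<in> clusters \<omega> \<and> infinite C \<longleftrightarrow> (\<exists>u. inf_cluster (cfg \<omega>) u \<and> C = emb ` cluster (cfg \<omega>) u)"
  unfolding clusters_emb inf_cluster_def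
  using finite_image_iff[OF inj_on_subset[OF inj_emb subset_UNIV]] by auto

section \<open>Almost sure statements for the infinite product measure\<close>

lemma prob_space_percolation: "prob_space (site_percolation p)"
  unfolding site_percolation_def by (intro prob_space_PiM measure_pmf.prob_space_axioms)

text \<open>The event is a finite disjoint union of the cylinders \<open>E A\<close>, whose
  probabilities are the weights in \<open>expec\<close>.\<close>

lemma measure_cfg:
  assumes "0 \<le> p" "p \<le> 1" "finite V"
  defines "M \<equiv> site_percolation p"
  shows "{\<omega> \<in> space M. Q (cfg \<omega> \<inter> V)} \<in> sets M"
    and "measure M {\<omega> \<in> space M. Q (cfg \<omega> \<inter> V)} = pr V p Q"
proof -
  interpret prob_space M
    unfolding M_def by (rule prob_space_percolation)
  interpret P: product_prob_space "\<lambda>_ :: complex. measure_pmf (bernoulli_pmf p)" tri_lattice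
    by unfold_locales
  define E where "E A = {\<omega> \<in> space M. cfg \<omega> \<inter> V = A}" for A
  \<comment> \<open>The factor at \<open>z\<close> is the singleton of a truth value, the prescribed
    state of \<open>z\<close>, and not a set comprehension.\<close>
  define B where "B A = prod_emb tri_lattice (\<lambda>_. measure_pmf (bernoulli_pmf p)) (emb ` V)
      (\<Pi>\<^sub>E z\<in>emb ` V. {z \<in> emb ` A})" for A
  have sub: "emb ` V \<subseteq> tri_lattice"
    using range_emb by auto
  have EB: "E A = B A" if "A \<subseteq> V" for A
  proof -
    have cyl: "prod_emb tri_lattice (\<lambda>_. measure_pmf (bernoulli_pmf p)) J (Pi\<^sub>E J X) =
        {\<omega> \<in> space M. \<forall>z\<in>J. \<omega> z \<in> X z}" if "J \<subseteq> tri_lattice" for J X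
      using that unfolding M_def site_percolation_def prod_emb_def by (auto simp: space_PiM Pi_iff)
    have "cfg \<omega> \<inter> V = A \<longleftrightarrow> (\<forall>u\<in>V. \<omega> (emb u) \<longleftrightarrow> u \<in> A)" for \<omega>
      using that by (auto simp: cfg_def)
    moreover have "emb u \<in> emb ` A \<longleftrightarrow> u \<in> A" for u
      using inj_emb by (rule inj_image_mem_iff)
    moreover have "B A = {\<omega> \<in> space M. \<forall>z\<in>emb ` V. \<omega> z \<in> {z \<in> emb ` A}}"
      unfolding B_def by (rule cyl[OF sub])
    ultimately show ?thesis by (simp add: E_def)
  qed
  have E_sets: "E A \<in> sets M" if "A \<subseteq> V" for A
    unfolding EB[OF that] B_def M_def site_percolation_def
    using sub assms(3) by (intro sets_PiM_I) auto
  have E_measure: "measure M (E A) = p ^ card A * (1 - p) ^ card (V - A)" if A: "A \<subseteq> V" for A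
  proof -
    have "measure M (E A) = (\<Prod>z\<in>emb ` V. measure (measure_pmf (bernoulli_pmf p)) {z \<in> emb ` A})"
      unfolding EB[OF A] B_def M_def site_percolation_def
      using sub assms(3) by (intro P.measure_PiM_emb) auto
    also have "\<dots> = (\<Prod>u\<in>V. pmf (bernoulli_pmf p) (u \<in> A))"
      using inj_emb by (subst prod.reindex) (auto simp: measure_pmf_single inj_image_mem_iff intro: inj_on_subset)
    also have "\<dots> = (\<Prod>u\<in>V. if u \<in> A then p else 1 - p)"
      using assms by (intro prod.cong) auto
    also have "\<dots> = p ^ card A * (1 - p) ^ card (V - A)"
      using A assms(3) by (simp add: prod.If_cases Int_absorb1 Diff_eq[symmetric])
    finally show ?thesis .
  qed
  have eq: "{\<omega> \<in> space M. Q (cfg \<omega> \<inter> V)} = (\<Union>A\<in>{A \<in> Pow V. Q A}. E A)"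
    by (auto simp: E_def)
  show "{\<omega> \<in> space M. Q (cfg \<omega> \<inter> V)} \<in> sets M"
    unfolding eq using assms(3) E_sets by (intro sets.finite_UN) auto
  have "measure M {\<omega> \<in> space M. Q (cfg \<omega> \<inter> V)} = (\<Sum>A\<in>{A \<in> Pow V. Q A}. measure M (E A))"
    unfolding eq using assms(3) E_sets
    by (intro finite_measure_finite_Union) (auto simp: disjoint_family_on_def E_def)
  also have "\<dots> = (\<Sum>A\<in>{A \<in> Pow V. Q A}. p ^ card A * (1 - p) ^ card (V - A))"
    using E_measure by (intro sum.cong) auto
  also have "\<dots> = pr V p Q"
    unfolding pr_def expec_def using assms(3) by (intro sum.mono_neutral_cong_left) auto
  finally show "measure M {\<omega> \<in> space M. Q (cfg \<omega> \<inter> V)} = pr V p Q" .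
qed

text \<open>An infinite cluster fits into no box, so its sites have arms of every length. For a
  fixed site this has probability at most \<open>C * s ^ n\<close> for all \<open>n\<close>, and
  there are countably many sites.\<close>

lemma AE_no_infinite_cluster:
  assumes "0 < p" "p < 1 / 2"
  shows "AE \<omega> in site_percolation p. \<not> (\<exists>C\<in>clusters \<omega>. infinite C)"
proof -
  define M where "M = site_percolation p"
  interpret prob_space M
    unfolding M_def by (rule prob_space_percolation)
  have p: "0 \<le> p" "p \<le> 1" using assms by auto
  obtain C s where Cs: "0 \<le> s" "s < 1" "\<And>n. theta n p \<le> C * s ^ n"
    using exponential_decay[OF assms] by metis
  have "AE \<omega> in M. \<not> inf_cluster (cfg \<omega>) v" for v
  proof -
    define N where "N n = {\<omega> \<in> space M. arm v n (cfg \<omega> \<inter> shift v (block n))}" for n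
    have N: "N n \<in> sets M" "measure M (N n) = theta n p" for n
      using measure_cfg[OF p, of "shift v (block n)" "arm v n"] pr_arm[of "shift v (block n)" v n p]
      by (simp_all add: N_def M_def)
    have "measure M (\<Inter>n. N n) \<le> C * s ^ n" for n
    proof -
      have "measure M (\<Inter>n. N n) \<le> measure M (N n)"
        using N(1) by (intro finite_measure_mono) auto
      then show ?thesis using Cs(3)[of n] N(2) by simp
    qed
    moreover have "(\<lambda>n. C * s ^ n) \<longlonglongrightarrow> C * 0"
      using Cs by (intro tendsto_intros LIMSEQ_realpow_zero)
    ultimately have "measure M (\<Inter>n. N n) \<le> C * 0"
      by (intro LIMSEQ_le_const) auto
    then have "measure M (\<Inter>n. N n) = 0"
      by (simp add: measure_le_0_iff)
    then have "(\<Inter>n. N n) \<in> null_sets M"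
      using N(1) by (auto simp: null_sets_def emeasure_eq_measure)
    then have "AE \<omega> in M. \<omega> \<notin> (\<Inter>n. N n)"
      by (rule AE_not_in)
    then show ?thesis
      using AE_space
    proof eventually_elim
      fix \<omega> assume \<omega>: "\<omega> \<notin> (\<Inter>n. N n)" "\<omega> \<in> space M"
      show "\<not> inf_cluster (cfg \<omega>) v"
      proof
        assume inf: "inf_cluster (cfg \<omega>) v"
        have "arm v n (cfg \<omega>)" for n
        proof -
          have "\<not> cluster (cfg \<omega>) v \<subseteq> shift v (block n)"
            using inf finite_subset[of "cluster (cfg \<omega>) v" "shift v (block n)"]
            unfolding inf_cluster_def by auto
          then obtain w where "con (cfg \<omega>) v w" "w \<notin> shift v (block n)"
            by (auto simp: cluster_def)
          then show ?thesis by (blast intro: armI)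
        qed
        then show False
          using \<omega> arm_local unfolding N_def by blast
      qed
    qed
  qed
  then have "AE \<omega> in M. \<forall>v. \<not> inf_cluster (cfg \<omega>) v"
    by (simp add: AE_all_countable)
  then show ?thesis
    unfolding M_def[symmetric] by eventually_elim (use infinite_cluster_iff in blast)
qed

lemma AE_unique_infinite_cluster:
  assumes "1 / 2 < p" "p < 1"
  shows "AE \<omega> in site_percolation p. \<exists>!C. C \<in> clusters \<omega> \<and> infinite C"
proof -
  define M where "M = site_percolation p"
  interpret prob_space M
    unfolding M_def by (rule prob_space_percolation)
  have p: "0 \<le> p" "p \<le> 1" "0 < 1 - p" "1 - p < 1 / 2" using assms by auto
  obtain C s where Cs: "0 \<le> C" "0 \<le> s" "s < 1" "\<And>n. theta n (1 - p) \<le> C * s ^ n"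
    using exponential_decay[OF p(3,4)] by metis
  define N where "N n = {\<omega> \<in> space M. \<not> good n (cfg \<omega> \<inter> block (6 * n))}" for n
  have N: "N n \<in> sets M" "measure M (N n) = pr (block (6 * n)) p (\<lambda>A. \<not> good n A)" for n
    using measure_cfg[OF p(1,2), of "block (6 * n)" "\<lambda>A. \<not> good n A"] by (simp_all add: N_def M_def)
  have "summable (\<lambda>n. of_nat (Suc n) * s ^ n)"
    using geometric_deriv_sums[of s] Cs by (auto simp: sums_iff)
  then have "summable (\<lambda>n. 32 * C * (of_nat (Suc n) * s ^ n))"
    by (rule summable_mult)
  moreover have "norm (measure M (N n)) \<le> 32 * C * (of_nat (Suc n) * s ^ n)" for n
  proof -
    have "measure M (N n) \<le> 4 * (real (8 * n + 1) * theta n (1 - p))"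
      unfolding N(2) using p by (intro pr_not_good)
    \<comment> \<open>The count \<open>8 * n + 1\<close> is rounded up to match the derivative of
      the geometric series.\<close>
    also have "\<dots> \<le> 4 * ((8 * real (Suc n)) * (C * s ^ n))"
      using Cs p theta_nonneg[of "1 - p" n] by (intro mult_left_mono mult_mono) auto
    finally show ?thesis by (simp add: mult_ac)
  qed
  ultimately have "summable (\<lambda>n. measure M (N n))"
    by (rule summable_comparison_test'[where N = 0])
  then have "AE \<omega> in M. eventually (\<lambda>n. \<omega> \<in> space M - N n) sequentially"
    using N(1) by (intro borel_cantelli_AE1) (auto simp: emeasure_eq_measure)
  then have "AE \<omega> in M. \<exists>n0. \<forall>n\<ge>n0. good n (cfg \<omega>)"
  proof eventually_elim
    fix \<omega> assume "eventually (\<lambda>n. \<omega> \<in> space M - N n) sequentially"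
    then show "\<exists>n0. \<forall>n\<ge>n0. good n (cfg \<omega>)"
      unfolding eventually_sequentially N_def using good_local by blast
  qed
  then show ?thesis
    unfolding M_def[symmetric]
  proof eventually_elim
    fix \<omega> assume "\<exists>n0. \<forall>n\<ge>n0. good n (cfg \<omega>)"
    then obtain n0 where n0: "\<And>n. n0 \<le> n \<Longrightarrow> good n (cfg \<omega>)" by blast
    obtain v where v: "inf_cluster (cfg \<omega>) v"
      using inf_cluster_exists[OF n0] by blast
    have eq: "cluster (cfg \<omega>) u = cluster (cfg \<omega>) v" if "inf_cluster (cfg \<omega>) u" for u
      using inf_cluster_unique[OF n0 that v] that cluster_eq_iff unfolding inf_cluster_def by blast
    show "\<exists>!C. C \<in> clusters \<omega> \<and> infinite C"
      unfolding infinite_cluster_iff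
    proof (rule ex1I[of _ "emb ` cluster (cfg \<omega>) v"])
      fix C assume "\<exists>u. inf_cluster (cfg \<omega>) u \<and> C = emb ` cluster (cfg \<omega>) u"
      then show "C = emb ` cluster (cfg \<omega>) v" using eq by metis
    qed (use v in blast)
  qed
qed

theorem theorem1p1:
  fixes p_c :: real
  shows "is_critical_point p_c \<longleftrightarrow> p_c = 1 / 2"
proof
  assume "p_c = 1 / 2"
  then show "is_critical_point p_c"
    using AE_no_infinite_cluster AE_unique_infinite_cluster by (simp add: is_critical_point_def)
next
  \<comment> \<open>The two regimes exclude each other at any single parameter, so a critical point
    other than \<open>1 / 2\<close> fails at a parameter strictly between the two.\<close>
  have contra: False
    if "AE \<omega> in site_percolation p. \<not> (\<exists>C\<in>clusters \<omega>. infinite C)"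
      "AE \<omega> in site_percolation p. \<exists>!C. C \<in> clusters \<omega> \<and> infinite C" for p
  proof -
    interpret prob_space "site_percolation p"
      by (rule prob_space_percolation)
    from that have "AE \<omega> in site_percolation p. False"
      by eventually_elim blast
    then show False by simp
  qed
  assume pc: "is_critical_point p_c"
  show "p_c = 1 / 2"
  proof (rule linorder_cases[of p_c "1 / 2"])
    assume "p_c < 1 / 2"
    then obtain p where "p_c < p" "p < 1 / 2" using dense by blast
    then show ?thesis
      using contra[of p] AE_no_infinite_cluster[of p] pc by (auto simp: is_critical_point_def)
  next
    assume "1 / 2 < p_c"
    then obtain p where "1 / 2 < p" "p < p_c" using dense by blast
    then show ?thesis
      using contra[of p] AE_unique_infinite_cluster[of p] pc by (auto simp: is_critical_point_def)
  qed
qed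

end
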